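(* Let $\nu>2$ and let $Y^*_{\nu}$ be a standard $t$ process with $\nu$ degrees of freedom and underlying correlation $\rho(\boldsymbol{h})$, i.e. $Y^*_{\nu}(\boldsymbol{s})=W_{\nu}(\boldsymbol{s})^{-1/2}G(\boldsymbol{s})$ with $G$ a standard Gaussian process with correlation function $\rho(\boldsymbol{h})$ and $W_\nu$ the independent Gamma mixing process built from $\rho$. Then the correlation function of $Y^*_\nu$ is $$\rho_{Y^*_{\nu}}(\boldsymbol{h})=\frac{(\nu-2)\,\Gamma^2\left(\frac{\nu-1}{2}\right)}{2\,\Gamma^2\left(\frac{\nu}{2}\right)}\left[{}_2F_1\left(\frac{1}{2},\frac{1}{2};\frac{\nu}{2};\rho^2(\boldsymbol{h})\right)\rho(\boldsymbol{h})\right].$$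
   Context: For a process $Q=\{Q(\boldsymbol{s}),\boldsymbol{s}\in A\}$, $A\subseteq\mathbb{R}^d$, the correlation function is $\rho_Q(\boldsymbol{h})=\mathrm{Corr}(Q(\boldsymbol{s}_i),Q(\boldsymbol{s}_j))$ with $\boldsymbol{h}=\boldsymbol{s}_i-\boldsymbol{s}_j$. Parent process: $G=\{G(\boldsymbol{s}),\boldsymbol{s}\in A\}$ is a weakly stationary Gaussian process with zero mean, unit variance and correlation function $\rho(\boldsymbol{h})$. Mixing process: for an integer $\nu$, $W_{\nu}(\boldsymbol{s}):=\frac1\nu\sum_{i=1}^{\nu}G_i(\boldsymbol{s})^2$, where $G_1,\dots,G_\nu$ are independent copies of $G$, also independent of $G$. The marginals of $W_\nu$ are $\Gamma(\nu/2,\nu/2)$ (shape, rate). The $t$ process is well defined for $\nu=3,4,\ldots$; for non-integer $\nu>2$ it is considered whenever the Gamma process exists (which is the case if $G^2$ is infinitely divisible). In that case $W_\nu$ is a positive process independent of $G$ with $\Gamma(\nu/2,\nu/2)$ marginals, whose bivariate density at two points with lag $\boldsymbol{h}$ and $\rho=\rho(\boldsymbol{h})$, $|\rho|<1$, is $$f(w_i,w_j)=\frac{2^{-\nu}\nu^{\nu}(w_iw_j)^{\nu/2-1}}{\Gamma^2(\nu/2)(1-\rho^2)^{\nu/2}}\,e^{-\frac{\nu(w_i+w_j)}{2(1-\rho^2)}}\,{}_0F_1\left(;\frac{\nu}{2};\frac{\nu^2\rho^2w_iw_j}{4(1-\rho^2)^2}\right),\quad w_i,w_j>0,$$ with ${}_0F_1(;b;x)=\sum_{k\ge0}\frac{x^k}{k!(b)_k}$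 (the same formula holds for integer $\nu$), and $W_\nu(\boldsymbol{s}_i)=W_\nu(\boldsymbol{s}_j)$ almost surely if $|\rho|=1$. The Gauss hypergeometric function is ${}_2F_1(a,b;c;x)=\sum_{k=0}^{\infty}\frac{(a)_k(b)_k}{(c)_k}\frac{x^k}{k!}$, with $(s)_k=\Gamma(s+k)/\Gamma(s)$. If $c>a+b$ the series converges for $0\le x\le 1$, and at $x=1$ it equals $\frac{\Gamma(c)\Gamma(c-a-b)}{\Gamma(c-a)\Gamma(c-b)}$. *)

theory Defs
  imports "HOL-Probability.Probability"
begin

definition hypergeo_0F1 :: "real \<Rightarrow> real \<Rightarrow> real" where
  "hypergeo_0F1 b x = (\<Sum>k. x ^ k / (fact k * pochhammer b k))"

definition hypergeo_2F1 :: "real \<Rightarrow> real \<Rightarrow> real \<Rightarrow> real \<Rightarrow> real" where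
  "hypergeo_2F1 a b c x =
     (\<Sum>k. pochhammer a k * pochhammer b k / pochhammer c k * (x ^ k / fact k))"

text \<open>Gamma density with shape \<open>a\<close> and rate \<open>b\<close>.\<close>

definition gamma_density :: "real \<Rightarrow> real \<Rightarrow> real \<Rightarrow> real" where
  "gamma_density a b x =
     (if x > 0 then b powr a / Gamma a * x powr (a - 1) * exp (- b * x) else 0)"

definition bivariate_gamma_density :: "real \<Rightarrow> real \<Rightarrow> real \<times> real \<Rightarrow> real" where
  "bivariate_gamma_density \<nu> r = (\<lambda>(x, y).
     if x > 0 \<and> y > 0 then
       2 powr (- \<nu>) * \<nu> powr \<nu> * (x * y) powr (\<nu> / 2 - 1)
         / ((Gamma (\<nu> / 2))\<^sup>2 * (1 - r\<^sup>2) powr (\<nu> / 2))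
       * exp (- (\<nu> * (x + y)) / (2 * (1 - r\<^sup>2)))
       * hypergeo_0F1 (\<nu> / 2) (\<nu>\<^sup>2 * r\<^sup>2 * x * y / (4 * (1 - r\<^sup>2)\<^sup>2))
     else 0)"

text \<open>
  A process on \<open>A\<close> is a family of real random variables of which only the members with
  index in \<open>A\<close> matter.  Its path map, into the product sigma-algebra over \<open>A\<close>, is used to
  express equality in law and independence of whole processes.
\<close>

definition path_on :: "'s set \<Rightarrow> ('s \<Rightarrow> 'w \<Rightarrow> real) \<Rightarrow> 'w \<Rightarrow> 's \<Rightarrow> real" where
  "path_on A Q = (\<lambda>\<omega>. \<lambda>s\<in>A. Q s \<omega>)"

context prob_space
begin

definition covariance :: "('a \<Rightarrow> real) \<Rightarrow> ('a \<Rightarrow> real) \<Rightarrow> real" where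
  "covariance X Y = expectation (\<lambda>\<omega>. (X \<omega> - expectation X) * (Y \<omega> - expectation Y))"

definition correlation :: "('a \<Rightarrow> real) \<Rightarrow> ('a \<Rightarrow> real) \<Rightarrow> real" where
  "correlation X Y = covariance X Y / sqrt (variance X * variance Y)"

text \<open>
  Finite second moments and positive variances are part of the definition: they make the
  correlations exist, whereas the Bochner integral is 0 on non-integrable functions.
\<close>

definition has_correlation_function ::
    "(real ^ 'd) set \<Rightarrow> (real ^ 'd \<Rightarrow> 'a \<Rightarrow> real) \<Rightarrow> (real ^ 'd \<Rightarrow> real) \<Rightarrow> bool" where
  "has_correlation_function A Q r \<longleftrightarrow>
     (\<forall>s\<in>A. random_variable borel (Q s) \<and> integrable M (\<lambda>\<omega>. (Q s \<omega>)\<^sup>2) \<and> variance (Q s) > 0)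
     \<and> (\<forall>s\<in>A. \<forall>t\<in>A. correlation (Q s) (Q t) = r (s - t))"

text \<open>Degenerate (almost surely constant) variables count as Gaussian.\<close>

definition gaussian_rv :: "('a \<Rightarrow> real) \<Rightarrow> bool" where
  "gaussian_rv X \<longleftrightarrow>
     (\<exists>\<mu> \<sigma>. \<sigma> > 0 \<and> distributed M lborel X (normal_density \<mu> \<sigma>))
     \<or> (random_variable borel X \<and> (\<exists>\<mu>. AE \<omega> in M. X \<omega> = \<mu>))"

definition gaussian_process :: "'s set \<Rightarrow> ('s \<Rightarrow> 'a \<Rightarrow> real) \<Rightarrow> bool" where
  "gaussian_process A G \<longleftrightarrow>
     (\<forall>F c. finite F \<and> F \<subseteq> A \<longrightarrow> gaussian_rv (\<lambda>\<omega>. \<Sum>s\<in>F. c s * G s \<omega>))"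

text \<open>
  Weak stationarity is contained in the last three conjuncts: the mean is constant and the
  covariance, being equal to the correlation, depends on the lag only.
\<close>

definition standard_gaussian_process ::
    "(real ^ 'd) set \<Rightarrow> (real ^ 'd \<Rightarrow> real) \<Rightarrow> (real ^ 'd \<Rightarrow> 'a \<Rightarrow> real) \<Rightarrow> bool" where
  "standard_gaussian_process A \<rho> G \<longleftrightarrow>
     gaussian_process A G
     \<and> (\<forall>s\<in>A. expectation (G s) = 0)
     \<and> (\<forall>s\<in>A. variance (G s) = 1)
     \<and> has_correlation_function A G \<rho>"

text \<open>
  The case of an integer number \<open>n\<close> of degrees of freedom: \<open>G\<close> (index 0) and its copies
  \<open>H 1, \<dots>, H n\<close> are mutually independent.
\<close>

definition chi_square_mixing ::
    "'s set \<Rightarrow> nat \<Rightarrow> ('s \<Rightarrow> 'a \<Rightarrow> real) \<Rightarrow> ('s \<Rightarrow> 'a \<Rightarrow> real) \<Rightarrow> bool" where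
  "chi_square_mixing A n G W \<longleftrightarrow>
     (\<exists>H :: nat \<Rightarrow> 's \<Rightarrow> 'a \<Rightarrow> real.
        indep_vars (\<lambda>_. Pi\<^sub>M A (\<lambda>_. borel)) (\<lambda>i. path_on A (if i = 0 then G else H i)) {0..n}
        \<and> (\<forall>i\<in>{1..n}. distr M (Pi\<^sub>M A (\<lambda>_. borel)) (path_on A (H i))
                        = distr M (Pi\<^sub>M A (\<lambda>_. borel)) (path_on A G))
        \<and> (\<forall>s\<in>A. \<forall>\<omega>\<in>space M. W s \<omega> = 1 / real n * (\<Sum>i=1..n. (H i s \<omega>)\<^sup>2)))"

text \<open>The case of a non-integer number of degrees of freedom.\<close>

definition gamma_mixing ::
    "(real ^ 'd) set \<Rightarrow> real \<Rightarrow> (real ^ 'd \<Rightarrow> real) \<Rightarrow> (real ^ 'd \<Rightarrow> 'a \<Rightarrow> real)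
       \<Rightarrow> (real ^ 'd \<Rightarrow> 'a \<Rightarrow> real) \<Rightarrow> bool" where
  "gamma_mixing A \<nu> \<rho> G W \<longleftrightarrow>
     indep_var (Pi\<^sub>M A (\<lambda>_. borel)) (path_on A W) (Pi\<^sub>M A (\<lambda>_. borel)) (path_on A G)
     \<and> (\<forall>s\<in>A. AE \<omega> in M. W s \<omega> > 0)
     \<and> (\<forall>s\<in>A. distributed M lborel (W s) (gamma_density (\<nu> / 2) (\<nu> / 2)))
     \<and> (\<forall>s\<in>A. \<forall>t\<in>A. \<bar>\<rho> (s - t)\<bar> < 1 \<longrightarrow>
          distributed M (lborel \<Otimes>\<^sub>M lborel) (\<lambda>\<omega>. (W s \<omega>, W t \<omega>))
            (bivariate_gamma_density \<nu> (\<rho> (s - t))))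
     \<and> (\<forall>s\<in>A. \<forall>t\<in>A. \<bar>\<rho> (s - t)\<bar> = 1 \<longrightarrow> (AE \<omega> in M. W s \<omega> = W t \<omega>))"

definition mixing_process ::
    "(real ^ 'd) set \<Rightarrow> real \<Rightarrow> (real ^ 'd \<Rightarrow> real) \<Rightarrow> (real ^ 'd \<Rightarrow> 'a \<Rightarrow> real)
       \<Rightarrow> (real ^ 'd \<Rightarrow> 'a \<Rightarrow> real) \<Rightarrow> bool" where
  "mixing_process A \<nu> \<rho> G W \<longleftrightarrow>
     (\<exists>n::nat. \<nu> = real n \<and> chi_square_mixing A n G W)
     \<or> (\<nu> \<notin> \<nat> \<and> gamma_mixing A \<nu> \<rho> G W)"

definition standard_t_process ::
    "(real ^ 'd) set \<Rightarrow> real \<Rightarrow> (real ^ 'd \<Rightarrow> real) \<Rightarrow> (real ^ 'd \<Rightarrow> 'a \<Rightarrow> real) \<Rightarrow> bool" where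
  "standard_t_process A \<nu> \<rho> Y \<longleftrightarrow>
     (\<exists>G W. standard_gaussian_process A \<rho> G \<and> mixing_process A \<nu> \<rho> G W
        \<and> (\<forall>s\<in>A. \<forall>\<omega>\<in>space M. Y s \<omega> = W s \<omega> powr (- 1 / 2) * G s \<omega>))"

end

end

theory Submission
  imports Defs
begin

text \<open>
  Write \<open>r\<close> for the value of \<open>\<rho>\<close> at the lag. By independence the correlation of \<open>Y\<close> is \<open>r\<close> times
  \<open>E[(W\<^sub>1 W\<^sub>2) powr (-1/2)] / E[1/W\<^sub>1]\<close>. For integer and for non-integer \<open>\<nu>\<close>, and also for \<open>r\<^sup>2 = 1\<close>,
  the pair \<open>(W\<^sub>1, W\<^sub>2)\<close> has the joint Laplace transform
  \<open>((1 + 2u/\<nu>) (1 + 2v/\<nu>) - 4uvr\<^sup>2/\<nu>\<^sup>2) powr (-\<nu>/2)\<close>.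
  Inserting \<open>w powr (-1/2) = pi powr (-1/2) * (integral over u > 0 of u powr (-1/2) * exp (-uw))\<close>,
  exchanging the integrals, and expanding the Laplace transform as a binomial series in \<open>r\<^sup>2\<close>
  leaves products of Beta integrals, which are the terms of \<open>2F1(1/2, 1/2; \<nu>/2; r\<^sup>2)\<close>. Neither Euler's
  transformation nor Gauss's summation theorem is needed.
\<close>

subsection \<open>Integrals on the half-line\<close>

text \<open>The integer case supplies sums of squares and no density, the non-integer case a joint
  density, and for \<open>\<bar>r\<bar> = 1\<close> the pair lies almost surely on the diagonal.
  What they share is the Laplace transform, whose base is the determinant of
  \<open>I + (2/\<nu>) diag(u,v) R\<close>, with \<open>R\<close> the correlation matrix of the
  Gaussian pair; each squared Gaussian pair contributes the exponent \<open>-1/2\<close>. Outside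
  the Gaussian part, integrals stay in \<open>ennreal\<close> as long as possible: the integrands
  are nonnegative, so exchanging integrals and sums asks for measurability only, and finiteness is
  settled afterwards. It comes from \<open>E[1/W] = \<nu>/(\<nu>-2)\<close>, finite because
  \<open>\<nu> > 2\<close>. This bounds the mixed moment through
  \<open>x y \<le> x\<^sup>2 + y\<^sup>2\<close> and thereby forces the hypergeometric series to
  converge, also at \<open>r\<^sup>2 = 1\<close>.\<close>

lemma ennreal_eq_divide:
  fixes c r :: real
  assumes "c > 0" and "ennreal c * I = ennreal r"
  shows "I = ennreal (r / c)"
proof -
  \<comment> \<open>Multiplying by the reciprocal avoids deciding first whether \<open>I\<close> is
    finite.\<close>
  have "ennreal (1 / c) * ennreal c = 1"
    using assms(1) by (simp add: ennreal_mult'[symmetric])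
  then have "I = ennreal (1 / c) * (ennreal c * I)"
    by (simp only: mult.assoc[symmetric] mult_1)
  also have "\<dots> = ennreal (1 / c * r)"
    unfolding assms(2) using assms(1) by (intro ennreal_mult'[symmetric]) simp
  finally show ?thesis by simp
qed

lemma nn_integral_Gamma_scaled:
  fixes a c :: real
  assumes "a > 0" "c > 0"
  shows "(\<integral>\<^sup>+x. ennreal (indicator {0<..} x * (x powr (a - 1) * exp (- (c * x)))) \<partial>lborel)
           = ennreal (Gamma a * c powr (- a))"
proof -
  let ?g = "\<lambda>x::real. ennreal (indicator {0..} x * x powr (a - 1) / exp x)"
  have "ennreal (Gamma a) = (\<integral>\<^sup>+x. ?g x \<partial>lborel)"
    using Gamma_conv_nn_integral_real[OF assms(1)] by simp
  also have "\<dots> = ennreal c * (\<integral>\<^sup>+x. ?g (0 + c * x) \<partial>lborel)"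
    using assms(2) by (subst nn_integral_real_affine[where c = c and t = 0]) auto
  also have "\<dots> = (\<integral>\<^sup>+x. ennreal c * ?g (0 + c * x) \<partial>lborel)"
    by (simp add: nn_integral_cmult)
  also have "\<dots> = (\<integral>\<^sup>+x. ennreal (c powr a) *
      ennreal (indicator {0<..} x * (x powr (a - 1) * exp (- (c * x)))) \<partial>lborel)"
  proof (intro nn_integral_cong)
    fix x :: real
    \<comment> \<open>At \<open>x = 0\<close> the two indicators differ, but
      \<open>0 powr (a - 1) = 0\<close>, so the integrands agree everywhere.\<close>
    have "c * (indicator {0..} (c * x) * (c * x) powr (a - 1) / exp (c * x))
        = c powr a * (indicator {0<..} x * (x powr (a - 1) * exp (- (c * x))))"
      using assms(2)
      by (auto simp: indicator_def powr_mult powr_diff exp_minus field_simps zero_le_mult_iff)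
    then show "ennreal c * ?g (0 + c * x) = ennreal (c powr a) *
      ennreal (indicator {0<..} x * (x powr (a - 1) * exp (- (c * x))))"
      using assms(2) by (simp add: ennreal_mult'[symmetric])
  qed
  also have "\<dots> = ennreal (c powr a) *
      (\<integral>\<^sup>+x. ennreal (indicator {0<..} x * (x powr (a - 1) * exp (- (c * x)))) \<partial>lborel)"
    by (simp add: nn_integral_cmult)
  finally have "ennreal (c powr a) *
      (\<integral>\<^sup>+x. ennreal (indicator {0<..} x * (x powr (a - 1) * exp (- (c * x)))) \<partial>lborel) = ennreal (Gamma a)"
    by (rule sym)
  then show ?thesis
    using assms by (subst ennreal_eq_divide) (auto simp: powr_minus divide_inverse)
qed

text \<open>The power of \<open>1 + d * u\<close> is, up to the factor \<open>Gamma (a + b)\<close>,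
  a Gamma integral over a new variable \<open>x\<close>. After the exchange the
  \<open>u\<close>-integral is again of Gamma type and gives \<open>(d * x) powr (- a)\<close>,
  which lowers the exponent of \<open>x\<close> so that the last integral is
  \<open>Gamma b\<close>.\<close>

lemma nn_integral_Beta_half_line:
  fixes a b d :: real
  assumes "a > 0" "b > 0" "d > 0"
  shows "(\<integral>\<^sup>+u. ennreal (indicator {0<..} u * (u powr (a - 1) * (1 + d * u) powr (- (a + b)))) \<partial>lborel)
           = ennreal (Gamma a * Gamma b / Gamma (a + b) * d powr (- a))"
proof -
  have G: "Gamma (a + b) > 0" using assms by simp
  let ?h = "\<lambda>u x::real. ennreal (indicator {0<..} u * (u powr (a - 1) *
              (indicator {0<..} x * (x powr (a + b - 1) * exp (- ((1 + d * u) * x))))))"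
  have "ennreal (Gamma (a + b)) *
      (\<integral>\<^sup>+u. ennreal (indicator {0<..} u * (u powr (a - 1) * (1 + d * u) powr (- (a + b)))) \<partial>lborel)
      = (\<integral>\<^sup>+u. (\<integral>\<^sup>+x. ?h u x \<partial>lborel) \<partial>lborel)"
  proof (subst nn_integral_cmult[symmetric], measurable, intro nn_integral_cong)
    fix u :: real
    have "(\<integral>\<^sup>+x. ?h u x \<partial>lborel) = (\<integral>\<^sup>+x. ennreal (indicator {0<..} u * u powr (a - 1)) *
       ennreal (indicator {0<..} x * (x powr (a + b - 1) * exp (- ((1 + d * u) * x)))) \<partial>lborel)"
      by (intro nn_integral_cong) (simp add: ennreal_mult'[symmetric] mult.assoc)
    also have "\<dots> = ennreal (indicator {0<..} u * u powr (a - 1)) *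
       (\<integral>\<^sup>+x. ennreal (indicator {0<..} x * (x powr (a + b - 1) * exp (- ((1 + d * u) * x)))) \<partial>lborel)"
      by (simp add: nn_integral_cmult)
    also have "\<dots> = ennreal (Gamma (a + b)) *
        ennreal (indicator {0<..} u * (u powr (a - 1) * (1 + d * u) powr (- (a + b))))"
    proof (cases "u > 0")
      case True
      then have "1 + d * u > 0" using assms by (simp add: add_pos_pos)
      then show ?thesis using True assms
        by (subst nn_integral_Gamma_scaled) (auto simp: ennreal_mult'[symmetric] mult_ac)
    qed auto
    finally show "ennreal (Gamma (a + b)) *
        ennreal (indicator {0<..} u * (u powr (a - 1) * (1 + d * u) powr (- (a + b)))) = (\<integral>\<^sup>+x. ?h u x \<partial>lborel)"
      by simp
  qed
  also have "\<dots> = (\<integral>\<^sup>+x. (\<integral>\<^sup>+u. ?h u x \<partial>lborel) \<partial>lborel)"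
    by (rule lborel_pair.Fubini') measurable
  also have "\<dots> = (\<integral>\<^sup>+x. ennreal (Gamma a * d powr (- a)) *
        ennreal (indicator {0<..} x * (x powr (b - 1) * exp (- (1 * x)))) \<partial>lborel)"
  proof (intro nn_integral_cong)
    fix x :: real
    have "(\<integral>\<^sup>+u. ?h u x \<partial>lborel) = (\<integral>\<^sup>+u. ennreal (indicator {0<..} x * (x powr (a + b - 1) * exp (- x))) *
       ennreal (indicator {0<..} u * (u powr (a - 1) * exp (- ((d * x) * u)))) \<partial>lborel)"
      by (intro nn_integral_cong)
         (simp add: ennreal_mult'[symmetric] indicator_def exp_add[symmetric] algebra_simps)
    also have "\<dots> = ennreal (indicator {0<..} x * (x powr (a + b - 1) * exp (- x))) *
       (\<integral>\<^sup>+u. ennreal (indicator {0<..} u * (u powr (a - 1) * exp (- ((d * x) * u)))) \<partial>lborel)"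
      by (simp add: nn_integral_cmult)
    also have "\<dots> = ennreal (Gamma a * d powr (- a)) *
        ennreal (indicator {0<..} x * (x powr (b - 1) * exp (- (1 * x))))"
    proof (cases "x > 0")
      case True
      have "x powr (a + b - 1) * x powr (- a) = x powr (b - 1)"
        by (simp add: powr_add[symmetric])
      then have "x powr (a + b - 1) * exp (- x) * (Gamma a * (d * x) powr - a)
          = Gamma a * d powr (- a) * (x powr (b - 1) * exp (- x))"
        using True assms by (simp add: powr_mult)
      then show ?thesis using True assms
        by (subst nn_integral_Gamma_scaled) (auto simp: ennreal_mult'[symmetric])
    qed auto
    finally show "(\<integral>\<^sup>+u. ?h u x \<partial>lborel) = ennreal (Gamma a * d powr (- a)) *
        ennreal (indicator {0<..} x * (x powr (b - 1) * exp (- (1 * x))))" .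
  qed
  also have "\<dots> = ennreal (Gamma a * d powr (- a)) * ennreal (Gamma b)"
    using nn_integral_Gamma_scaled[OF assms(2), of 1] by (simp add: nn_integral_cmult)
  also have "\<dots> = ennreal (Gamma a * Gamma b * d powr (- a))"
    using assms by (simp add: ennreal_mult'[symmetric] mult_ac)
  finally show ?thesis
    using ennreal_eq_divide[OF G] by simp
qed

text \<open>Newton's series at exponent \<open>- c\<close> and argument \<open>- x\<close>: the two
  signs \<open>(-1) ^ k\<close> cancel. For \<open>c \<ge> 0\<close> and \<open>x \<ge> 0\<close>
  all terms are therefore nonnegative, which permits termwise integration in
  \<open>ennreal\<close>.\<close>

lemma negative_binomial_series:
  fixes c x :: real
  assumes "\<bar>x\<bar> < 1"
  shows "(\<lambda>k. pochhammer c k / fact k * x ^ k) sums (1 - x) powr (- c)"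
proof -
  have "(\<lambda>k. ((- c) gchoose k) * (- x) ^ k) sums (1 + - x) powr (- c)"
    using assms by (intro gen_binomial_real) auto
  moreover have "((- c) gchoose k) * (- x) ^ k = pochhammer c k / fact k * x ^ k" for k
    by (simp add: gbinomial_pochhammer power_mult_distrib[symmetric] mult.assoc)
  ultimately show ?thesis by simp
qed

subsection \<open>Inverse moments from Laplace transforms\<close>

lemma nn_integral_inverse_sqrt_prod:
  fixes x y :: real
  assumes "x > 0" "y > 0"
  shows "(\<integral>\<^sup>+u. \<integral>\<^sup>+v. ennreal (indicator {0<..} u * (u powr (- 1 / 2) * (indicator {0<..} v *
            (v powr (- 1 / 2) * exp (- (u * x + v * y)))))) \<partial>lborel \<partial>lborel)
         = ennreal (pi * (x powr (- 1 / 2) * y powr (- 1 / 2)))"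
proof -
  have *: "(\<integral>\<^sup>+u. ennreal (indicator {0<..} u * (u powr (- 1 / 2) * exp (- (u * z)))) \<partial>lborel)
            = ennreal (sqrt pi * z powr (- 1 / 2))" if "z > 0" for z :: real
    using nn_integral_Gamma_scaled[of "1/2" z] that by (simp add: Gamma_one_half_real mult.commute)
  have "(\<integral>\<^sup>+u. \<integral>\<^sup>+v. ennreal (indicator {0<..} u * (u powr (- 1 / 2) * (indicator {0<..} v *
            (v powr (- 1 / 2) * exp (- (u * x + v * y)))))) \<partial>lborel \<partial>lborel)
      = (\<integral>\<^sup>+u. \<integral>\<^sup>+v. ennreal (indicator {0<..} u * (u powr (- 1 / 2) * exp (- (u * x)))) *
            ennreal (indicator {0<..} v * (v powr (- 1 / 2) * exp (- (v * y)))) \<partial>lborel \<partial>lborel)"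
    by (intro nn_integral_cong) (simp add: ennreal_mult'[symmetric] exp_add[symmetric] mult_ac)
  also have "\<dots> = ennreal (sqrt pi * x powr (- 1 / 2)) * ennreal (sqrt pi * y powr (- 1 / 2))"
    using *[OF assms(1)] *[OF assms(2)] by (simp add: nn_integral_cmult nn_integral_multc)
  also have "\<dots> = ennreal (pi * (x powr (- 1 / 2) * y powr (- 1 / 2)))"
    by (simp add: ennreal_mult'[symmetric] mult_ac)
  finally show ?thesis .
qed

text \<open>Factoring out \<open>P = (1 + d * u) * (1 + d * v)\<close> with
  \<open>d = 2 / \<nu>\<close> leaves \<open>(1 - x) powr (- (\<nu> / 2))\<close>, where
  \<open>x\<close> is itself a product of a function of \<open>u\<close> and one of
  \<open>v\<close>. Each term of the binomial series thus separates into the square of one Beta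
  integral.\<close>

lemma nn_integral_bivariate_Laplace:
  fixes \<nu> r :: real
  assumes nu: "\<nu> > 2" and r: "\<bar>r\<bar> \<le> 1"
  shows "(\<integral>\<^sup>+u. \<integral>\<^sup>+v. ennreal (indicator {0<..} u * (u powr (- 1 / 2) * (indicator {0<..} v *
            (v powr (- 1 / 2) * ((1 + 2 / \<nu> * u) * (1 + 2 / \<nu> * v) - (2 / \<nu>)\<^sup>2 * u * v * r\<^sup>2) powr (- (\<nu> / 2))))))
            \<partial>lborel \<partial>lborel)
         = (\<Sum>k. ennreal (pi * (\<nu> / 2) * (Gamma ((\<nu> - 1) / 2))\<^sup>2 / (Gamma (\<nu> / 2))\<^sup>2 *
             (pochhammer (1 / 2) k * pochhammer (1 / 2) k / pochhammer (\<nu> / 2) k * ((r\<^sup>2) ^ k / fact k))))"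
proof -
  define d where "d = 2 / \<nu>"
  have d: "d > 0" using nu by (simp add: d_def)
  define c where "c = (\<lambda>k. pochhammer (\<nu> / 2) k / fact k * (r\<^sup>2) ^ k)"
  have c: "c k \<ge> 0" for k
    using nu unfolding c_def by (intro mult_nonneg_nonneg divide_nonneg_pos) (auto intro!: pochhammer_nonneg)
  \<comment> \<open>The exponents keep the shape \<open>a - 1\<close> and \<open>- (a + b)\<close>
    with \<open>a = k + 1/2\<close> and \<open>b = (\<nu> - 1) / 2\<close>, as in the Beta integral;
    their sum is \<open>k + \<nu> / 2\<close>.\<close>
  define g where "g = (\<lambda>k u. indicator {0<..} u * (u powr ((real k + 1 / 2) - 1) *
      (1 + d * u) powr (- ((real k + 1 / 2) + (\<nu> - 1) / 2))))"
  have g: "g k u \<ge> 0" for k u by (simp add: g_def)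
  have gm [measurable]: "g k \<in> borel_measurable borel" for k unfolding g_def by measurable
  have series: "ennreal (indicator {0<..} u * (u powr (- 1 / 2) * (indicator {0<..} v *
            (v powr (- 1 / 2) * ((1 + d * u) * (1 + d * v) - d\<^sup>2 * u * v * r\<^sup>2) powr (- (\<nu> / 2))))))
        = (\<Sum>k. ennreal (c k * d ^ (2 * k)) * (ennreal (g k u) * ennreal (g k v)))" for u v
  proof (cases "u > 0 \<and> v > 0")
    case False
    then have "u \<le> 0 \<or> v \<le> 0" by auto
    then show ?thesis by (auto simp: g_def)
  next
    case True
    define P where "P = (1 + d * u) * (1 + d * v)"
    define x where "x = d\<^sup>2 * u * v * r\<^sup>2 / P"
    have pos: "1 + d * u > 0" "1 + d * v > 0" using True d by (auto intro: add_pos_pos)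
    then have P: "P > 0" by (simp add: P_def)
    have "r\<^sup>2 \<le> 1" using r by (simp add: abs_square_le_1)
    then have "d\<^sup>2 * u * v * r\<^sup>2 \<le> d\<^sup>2 * u * v * 1"
      using True by (intro mult_left_mono) auto
    \<comment> \<open>The gap is at least \<open>1 + d * u + d * v\<close>, so \<open>x < 1\<close>
      holds strictly even for \<open>r\<^sup>2 = 1\<close> and the boundary case needs no limit
      argument.\<close>
    also have "\<dots> < P"
      using True d by (simp add: P_def algebra_simps power2_eq_square add_pos_pos)
    finally have x: "0 \<le> x" "x < 1" using P True by (auto simp: x_def)
    have "(1 + d * u) * (1 + d * v) - d\<^sup>2 * u * v * r\<^sup>2 = P * (1 - x)"
      using P by (simp add: x_def P_def field_simps)
    then have eq: "((1 + d * u) * (1 + d * v) - d\<^sup>2 * u * v * r\<^sup>2) powr (- (\<nu> / 2))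
        = P powr (- (\<nu> / 2)) * (1 - x) powr (- (\<nu> / 2))"
      using P x by (simp add: powr_mult)
    define B where "B = u powr (- 1 / 2) * v powr (- 1 / 2) * P powr (- (\<nu> / 2))"
    have "(\<lambda>k. B * (pochhammer (\<nu> / 2) k / fact k * x ^ k)) sums (B * (1 - x) powr (- (\<nu> / 2)))"
      using x by (intro sums_mult negative_binomial_series) auto
    moreover have "B * (pochhammer (\<nu> / 2) k / fact k * x ^ k) = c k * d ^ (2 * k) * (g k u * g k v)" for k
    proof -
      have g1: "g k w = w ^ k * w powr (- 1 / 2) * ((1 + d * w) powr (- (\<nu> / 2)) / (1 + d * w) ^ k)"
        if "w > 0" for w
      proof -
        have "1 + d * w > 0" using that d by (auto intro: add_pos_pos)
        moreover have "real k + 1 / 2 - 1 = real k + (- 1 / 2)"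
          "- (real k + 1 / 2 + (\<nu> - 1) / 2) = - (\<nu> / 2) - real k" by (auto simp: field_simps)
        ultimately show ?thesis using that unfolding g_def
          by (simp only: powr_add powr_diff powr_realpow) simp
      qed
      have Pp: "P powr (- (\<nu> / 2)) = (1 + d * u) powr (- (\<nu> / 2)) * (1 + d * v) powr (- (\<nu> / 2))"
        using pos by (simp add: P_def powr_mult)
      have xk: "x ^ k = d ^ (2 * k) * u ^ k * v ^ k * (r\<^sup>2) ^ k / ((1 + d * u) ^ k * (1 + d * v) ^ k)"
        by (simp add: x_def P_def power_mult_distrib power_divide power_mult)
      show ?thesis using True by (simp add: g1 B_def Pp xk c_def)
    qed
    ultimately have S: "(\<lambda>k. c k * d ^ (2 * k) * (g k u * g k v)) sums (B * (1 - x) powr (- (\<nu> / 2)))"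
      by simp
    have "(\<Sum>k. ennreal (c k * d ^ (2 * k)) * (ennreal (g k u) * ennreal (g k v)))
        = (\<Sum>k. ennreal (c k * d ^ (2 * k) * (g k u * g k v)))"
      using c g d by (simp add: ennreal_mult'[symmetric] ennreal_mult[symmetric])
    also have "\<dots> = ennreal (B * (1 - x) powr (- (\<nu> / 2)))"
      using S c g d by (subst suminf_ennreal2) (auto simp: sums_iff intro!: mult_nonneg_nonneg)
    finally show ?thesis unfolding eq using True by (simp add: B_def mult_ac)
  qed
  have gint: "(\<integral>\<^sup>+u. ennreal (g k u) \<partial>lborel)
      = ennreal (Gamma (real k + 1 / 2) * Gamma ((\<nu> - 1) / 2) / Gamma (real k + \<nu> / 2) * d powr (- (real k + 1 / 2)))" for k
  proof -
    have e: "real k + 1 / 2 + (\<nu> - 1) / 2 = real k + \<nu> / 2" by (simp add: field_simps)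
    have "(\<integral>\<^sup>+u. ennreal (g k u) \<partial>lborel) = ennreal (Gamma (real k + 1 / 2) * Gamma ((\<nu> - 1) / 2) /
        Gamma (real k + 1 / 2 + (\<nu> - 1) / 2) * d powr (- (real k + 1 / 2)))"
      unfolding g_def using nu d by (intro nn_integral_Beta_half_line) auto
    then show ?thesis by (simp only: e)
  qed
  \<comment> \<open>The Pochhammer symbol in \<open>c k\<close> cancels one of the two factors
    \<open>1 / Gamma (k + \<nu> / 2)\<close>, so that a single one stays in the denominator. The two
    factors \<open>Gamma (k + 1/2)\<close> supply the numerator and the constant
    \<open>pi\<close>.\<close>
  have coeff: "ennreal (c k * d ^ (2 * k)) * ((\<integral>\<^sup>+u. ennreal (g k u) \<partial>lborel) * (\<integral>\<^sup>+u. ennreal (g k u) \<partial>lborel))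
     = ennreal (pi * (\<nu> / 2) * (Gamma ((\<nu> - 1) / 2))\<^sup>2 / (Gamma (\<nu> / 2))\<^sup>2 *
             (pochhammer (1 / 2) k * pochhammer (1 / 2) k / pochhammer (\<nu> / 2) k * ((r\<^sup>2) ^ k / fact k)))" for k
  proof -
    have G: "Gamma (\<nu> / 2) > 0" "Gamma (real k + \<nu> / 2) > 0" "Gamma (real k + 1 / 2) > 0" "Gamma ((\<nu> - 1) / 2) > 0"
      using nu by (auto intro!: add_nonneg_pos)
    have p1: "pochhammer (\<nu> / 2) k = Gamma (real k + \<nu> / 2) / Gamma (\<nu> / 2)"
      using nu by (subst pochhammer_Gamma) (auto simp: add.commute)
    have p2: "pochhammer (1 / 2) k = Gamma (real k + 1 / 2) / sqrt pi"
      by (subst pochhammer_Gamma) (auto simp: add.commute Gamma_one_half_real)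
    \<comment> \<open>The powers \<open>d ^ (2 * k)\<close> cancel in the end; the surplus
      \<open>1 / d\<close> is the source of the constant \<open>\<nu> / 2\<close>.\<close>
    have "d powr (- (real k + 1 / 2)) * d powr (- (real k + 1 / 2)) = d powr (- (real (2 * k)) - 1)"
      unfolding powr_add[symmetric] by (rule arg_cong[where f = "\<lambda>x. d powr x"]) simp
    also have "\<dots> = (\<nu> / 2) / d ^ (2 * k)"
      using d by (simp only: powr_diff powr_minus powr_realpow) (simp add: d_def field_simps)
    finally have d2: "d powr (- (real k + 1 / 2)) * d powr (- (real k + 1 / 2)) = (\<nu> / 2) / d ^ (2 * k)" .
    define q where "q = Gamma (real k + 1 / 2) * Gamma ((\<nu> - 1) / 2) / Gamma (real k + \<nu> / 2)"
    define p where "p = d powr (- (real k + 1 / 2))"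
    have q: "q \<ge> 0" using G by (simp add: q_def)
    have "ennreal (c k * d ^ (2 * k)) * (ennreal (q * p) * ennreal (q * p)) = ennreal (c k * d ^ (2 * k) * (q * p * (q * p)))"
      using c[of k] d q by (simp add: ennreal_mult p_def)
    also have "c k * d ^ (2 * k) * (q * p * (q * p)) = c k * d ^ (2 * k) * q\<^sup>2 * (p * p)"
      by (simp add: power2_eq_square mult_ac)
    also have "\<dots> = c k * q\<^sup>2 * (\<nu> / 2)"
      unfolding d2[folded p_def] using d by simp
    also have "\<dots> = pi * (\<nu> / 2) * (Gamma ((\<nu> - 1) / 2))\<^sup>2 / (Gamma (\<nu> / 2))\<^sup>2 *
             (pochhammer (1 / 2) k * pochhammer (1 / 2) k / pochhammer (\<nu> / 2) k * ((r\<^sup>2) ^ k / fact k))"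
      unfolding c_def p1 p2 q_def using G by (simp add: field_simps power2_eq_square)
    finally show ?thesis unfolding gint p_def q_def .
  qed
  have "(\<integral>\<^sup>+u. \<integral>\<^sup>+v. ennreal (indicator {0<..} u * (u powr (- 1 / 2) * (indicator {0<..} v *
            (v powr (- 1 / 2) * ((1 + d * u) * (1 + d * v) - d\<^sup>2 * u * v * r\<^sup>2) powr (- (\<nu> / 2))))))
            \<partial>lborel \<partial>lborel)
      = (\<Sum>k. ennreal (c k * d ^ (2 * k)) * ((\<integral>\<^sup>+u. ennreal (g k u) \<partial>lborel) * (\<integral>\<^sup>+u. ennreal (g k u) \<partial>lborel)))"
    unfolding series by (simp add: nn_integral_suminf nn_integral_cmult nn_integral_multc)
  then show ?thesis unfolding coeff by (simp add: d_def)
qed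

text \<open>Only positivity and the joint transform of the pair enter, so sums of squares, pairs
  with a density and almost surely equal variables are all served at once. The right side stays an
  \<open>ennreal\<close> series because its finiteness is not yet known.\<close>

lemma (in prob_space) nn_integral_inverse_sqrt_prod_Laplace:
  fixes \<nu> r :: real and V W :: "'a \<Rightarrow> real"
  assumes nu: "\<nu> > 2" and r: "\<bar>r\<bar> \<le> 1"
    and [measurable]: "V \<in> borel_measurable M" "W \<in> borel_measurable M"
    and pos: "AE \<omega> in M. V \<omega> > 0" "AE \<omega> in M. W \<omega> > 0"
    and Laplace: "\<And>u v. u > 0 \<Longrightarrow> v > 0 \<Longrightarrow> (\<integral>\<^sup>+\<omega>. ennreal (exp (- (u * V \<omega> + v * W \<omega>))) \<partial>M)
         = ennreal (((1 + 2 / \<nu> * u) * (1 + 2 / \<nu> * v) - (2 / \<nu>)\<^sup>2 * u * v * r\<^sup>2) powr (- (\<nu> / 2)))"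
  shows "(\<integral>\<^sup>+\<omega>. ennreal (V \<omega> powr (- 1 / 2) * W \<omega> powr (- 1 / 2)) \<partial>M)
     = (\<Sum>k. ennreal (\<nu> / 2 * (Gamma ((\<nu> - 1) / 2))\<^sup>2 / (Gamma (\<nu> / 2))\<^sup>2 *
             (pochhammer (1 / 2) k * pochhammer (1 / 2) k / pochhammer (\<nu> / 2) k * ((r\<^sup>2) ^ k / fact k))))"
    (is "?L = (\<Sum>k. ennreal (?R k))")
proof -
  interpret p: pair_sigma_finite lborel M
    by (intro pair_sigma_finite.intro sigma_finite_measure_axioms lborel.sigma_finite_measure_axioms)
  let ?k = "\<lambda>u v e. ennreal (indicator {0<..} u * (u powr (- 1 / 2) * (indicator {0<..} v *
            (v powr (- 1 / 2) * e))))"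
  have k: "?k u v e = ?k u v 1 * ennreal e" for u v e :: real
    by (simp add: ennreal_mult'[symmetric] mult.assoc)
  \<comment> \<open>The factor \<open>pi\<close> is carried along and cancelled at the end;
    cancelling in \<open>ennreal\<close> only asks that it be neither zero nor infinite.\<close>
  have "ennreal pi * ?L = (\<integral>\<^sup>+\<omega>. ennreal pi * ennreal (V \<omega> powr (- 1 / 2) * W \<omega> powr (- 1 / 2)) \<partial>M)"
    by (simp add: nn_integral_cmult)
  also have "\<dots> = (\<integral>\<^sup>+\<omega>. (\<integral>\<^sup>+u. \<integral>\<^sup>+v. ?k u v (exp (- (u * V \<omega> + v * W \<omega>))) \<partial>lborel \<partial>lborel) \<partial>M)"
    using pos by (intro nn_integral_cong_AE, eventually_elim)
      (subst nn_integral_inverse_sqrt_prod, auto simp: ennreal_mult'[symmetric])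
  also have "\<dots> = (\<integral>\<^sup>+u. \<integral>\<^sup>+\<omega>. \<integral>\<^sup>+v. ?k u v (exp (- (u * V \<omega> + v * W \<omega>))) \<partial>lborel \<partial>M \<partial>lborel)"
    by (rule p.Fubini') measurable
  also have "\<dots> = (\<integral>\<^sup>+u. \<integral>\<^sup>+v. \<integral>\<^sup>+\<omega>. ?k u v (exp (- (u * V \<omega> + v * W \<omega>))) \<partial>M \<partial>lborel \<partial>lborel)"
    by (intro nn_integral_cong p.Fubini') measurable
  also have "\<dots> = (\<integral>\<^sup>+u. \<integral>\<^sup>+v. ?k u v (((1 + 2 / \<nu> * u) * (1 + 2 / \<nu> * v) - (2 / \<nu>)\<^sup>2 * u * v * r\<^sup>2) powr (- (\<nu> / 2)))
       \<partial>lborel \<partial>lborel)"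
  proof (intro nn_integral_cong)
    fix u v :: real
    have "(\<integral>\<^sup>+\<omega>. ?k u v (exp (- (u * V \<omega> + v * W \<omega>))) \<partial>M)
        = ?k u v 1 * (\<integral>\<^sup>+\<omega>. ennreal (exp (- (u * V \<omega> + v * W \<omega>))) \<partial>M)"
      by (subst k) (simp add: nn_integral_cmult)
    also have "\<dots> = ?k u v (((1 + 2 / \<nu> * u) * (1 + 2 / \<nu> * v) - (2 / \<nu>)\<^sup>2 * u * v * r\<^sup>2) powr (- (\<nu> / 2)))"
    \<comment> \<open>Outside the open quadrant \<open>Laplace\<close> says nothing, but there the
      indicators make both sides vanish.\<close>
    proof (cases "u > 0 \<and> v > 0")
      case True
      then have "u > 0" "v > 0" by auto
      from Laplace[OF this] show ?thesis by (simp only: k[symmetric])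
    qed (auto simp: indicator_def)
    finally show "(\<integral>\<^sup>+\<omega>. ?k u v (exp (- (u * V \<omega> + v * W \<omega>))) \<partial>M)
        = ?k u v (((1 + 2 / \<nu> * u) * (1 + 2 / \<nu> * v) - (2 / \<nu>)\<^sup>2 * u * v * r\<^sup>2) powr (- (\<nu> / 2)))" .
  qed
  also have "\<dots> = (\<Sum>k. ennreal (pi * (\<nu> / 2) * (Gamma ((\<nu> - 1) / 2))\<^sup>2 / (Gamma (\<nu> / 2))\<^sup>2 *
             (pochhammer (1 / 2) k * pochhammer (1 / 2) k / pochhammer (\<nu> / 2) k * ((r\<^sup>2) ^ k / fact k))))"
    by (rule nn_integral_bivariate_Laplace[OF nu r])
  also have "\<dots> = (\<Sum>k. ennreal pi * ennreal (?R k))"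
    by (simp add: ennreal_mult'[symmetric] mult.assoc)
  also have "\<dots> = ennreal pi * (\<Sum>k. ennreal (?R k))"
    by (rule ennreal_suminf_cmult)
  finally show ?thesis
    by (subst (asm) ennreal_mult_cancel_left) auto
qed

text \<open>Since \<open>1 / w\<close> is the integral of \<open>exp (- (u * w))\<close> over
  \<open>u > 0\<close>, the inverse moment is the integral of the transform. That is a Beta integral
  with \<open>a = 1\<close> and \<open>b = \<nu> / 2 - 1\<close>, and \<open>\<nu> > 2\<close> says
  exactly that \<open>b\<close> is positive.\<close>

lemma (in prob_space) nn_integral_inverse_Laplace:
  fixes \<nu> :: real and W :: "'a \<Rightarrow> real"
  assumes nu: "\<nu> > 2"
    and [measurable]: "W \<in> borel_measurable M"
    and pos: "AE \<omega> in M. W \<omega> > 0"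
    and Laplace: "\<And>u. u > 0 \<Longrightarrow> (\<integral>\<^sup>+\<omega>. ennreal (exp (- (u * W \<omega>))) \<partial>M)
         = ennreal ((1 + 2 / \<nu> * u) powr (- (\<nu> / 2)))"
  shows "(\<integral>\<^sup>+\<omega>. ennreal (1 / W \<omega>) \<partial>M) = ennreal (\<nu> / (\<nu> - 2))"
proof -
  interpret p: pair_sigma_finite lborel M
    by (intro pair_sigma_finite.intro sigma_finite_measure_axioms lborel.sigma_finite_measure_axioms)
  have 1: "(\<integral>\<^sup>+u. ennreal (indicator {0<..} u * exp (- (u * w))) \<partial>lborel) = ennreal (1 / w)"
    if "w > 0" for w :: real
  proof -
    have "(\<integral>\<^sup>+u. ennreal (indicator {0<..} u * exp (- (u * w))) \<partial>lborel)
      = (\<integral>\<^sup>+u. ennreal (indicator {0<..} u * (u powr (1 - 1) * exp (- (w * u)))) \<partial>lborel)"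
      by (intro nn_integral_cong) (auto simp: indicator_def mult.commute)
    then show ?thesis using nn_integral_Gamma_scaled[of 1 w] that by (simp add: powr_minus divide_inverse)
  qed
  have "(\<integral>\<^sup>+\<omega>. ennreal (1 / W \<omega>) \<partial>M) = (\<integral>\<^sup>+\<omega>. \<integral>\<^sup>+u. ennreal (indicator {0<..} u * exp (- (u * W \<omega>))) \<partial>lborel \<partial>M)"
    using pos by (intro nn_integral_cong_AE, eventually_elim) (simp add: 1)
  also have "\<dots> = (\<integral>\<^sup>+u. \<integral>\<^sup>+\<omega>. ennreal (indicator {0<..} u * exp (- (u * W \<omega>))) \<partial>M \<partial>lborel)"
    by (rule p.Fubini') measurable
  also have "\<dots> = (\<integral>\<^sup>+u. ennreal (indicator {0<..} u * (u powr (1 - 1) * (1 + 2 / \<nu> * u) powr (- (1 + (\<nu> / 2 - 1))))) \<partial>lborel)"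
  proof (intro nn_integral_cong)
    fix u :: real
    show "(\<integral>\<^sup>+\<omega>. ennreal (indicator {0<..} u * exp (- (u * W \<omega>))) \<partial>M) =
       ennreal (indicator {0<..} u * (u powr (1 - 1) * (1 + 2 / \<nu> * u) powr (- (1 + (\<nu> / 2 - 1)))))"
      using Laplace[of u] by (auto simp: indicator_def)
  qed
  also have "\<dots> = ennreal (Gamma 1 * Gamma (\<nu> / 2 - 1) / Gamma (1 + (\<nu> / 2 - 1)) * (2 / \<nu>) powr (- 1))"
    using nu by (intro nn_integral_Beta_half_line) auto
  also have "Gamma (1 + (\<nu> / 2 - 1)) = (\<nu> / 2 - 1) * Gamma (\<nu> / 2 - 1)"
    using nu Gamma_plus1[of "\<nu> / 2 - 1"] nonpos_Ints_nonpos[of "\<nu> / 2 - 1"] by (auto simp: add.commute)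
  also have "Gamma 1 * Gamma (\<nu> / 2 - 1) / ((\<nu> / 2 - 1) * Gamma (\<nu> / 2 - 1)) * (2 / \<nu>) powr (- 1) = \<nu> / (\<nu> - 2)"
  proof -
    have "Gamma (\<nu> / 2 - 1) > 0" using nu by simp
    then have "Gamma 1 * Gamma (\<nu> / 2 - 1) / ((\<nu> / 2 - 1) * Gamma (\<nu> / 2 - 1)) = 1 / (\<nu> / 2 - 1)"
      by simp
    then show ?thesis using nu by (simp only:) (simp add: powr_minus field_simps)
  qed
  finally show ?thesis .
qed

subsection \<open>Laplace transforms of the Gamma densities\<close>

text \<open>Serves the lags with \<open>\<bar>\<rho>\<bar> = 1\<close>, where the pair reduces to
  one Gamma variable and the transform is taken at the sum of the two arguments.\<close>

lemma nn_integral_gamma_density_exp: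
  fixes \<nu> u :: real
  assumes nu: "\<nu> > 0" and u: "u \<ge> 0"
  shows "(\<integral>\<^sup>+x. ennreal (gamma_density (\<nu> / 2) (\<nu> / 2) x) * ennreal (exp (- (u * x))) \<partial>lborel)
         = ennreal ((1 + 2 / \<nu> * u) powr (- (\<nu> / 2)))"
proof -
  define b where "b = \<nu> / 2"
  have b: "b > 0" "b + u > 0" using nu u by (auto simp: b_def)
  have G: "Gamma b > 0" using b by simp
  have "(\<integral>\<^sup>+x. ennreal (gamma_density b b x) * ennreal (exp (- (u * x))) \<partial>lborel)
     = (\<integral>\<^sup>+x. ennreal (b powr b / Gamma b) * ennreal (indicator {0<..} x * (x powr (b - 1) * exp (- ((b + u) * x)))) \<partial>lborel)"
    using G by (intro nn_integral_cong)
      (auto simp: gamma_density_def ennreal_mult'[symmetric] exp_add[symmetric] algebra_simps)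
  also have "\<dots> = ennreal (b powr b / Gamma b) * ennreal (Gamma b * (b + u) powr (- b))"
    by (subst nn_integral_cmult) (use b in \<open>simp_all add: nn_integral_Gamma_scaled\<close>)
  also have "\<dots> = ennreal (b powr b * (b + u) powr (- b))"
    using G by (simp add: ennreal_mult'[symmetric])
  also have "b powr b * (b + u) powr (- b) = ((b + u) / b) powr (- b)"
    using b by (simp add: powr_divide powr_minus field_simps)
  also have "(b + u) / b = 1 + 2 / \<nu> * u"
    using nu by (simp add: b_def field_simps)
  finally show ?thesis by (simp add: b_def)
qed

text \<open>For \<open>b \<ge> 1\<close> every Pochhammer symbol is at least 1, so the exponential
  series dominates. With \<open>b = \<nu> / 2\<close> this covers all
  \<open>\<nu> \<ge> 2\<close>.\<close>

lemma hypergeo_0F1_sums: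
  fixes b x :: real
  assumes "b \<ge> 1" "x \<ge> 0"
  shows "(\<lambda>k. x ^ k / (fact k * pochhammer b k)) sums hypergeo_0F1 b x"
proof -
  have *: "pochhammer b k \<ge> 1" for k
    unfolding pochhammer_prod using assms(1) by (intro prod_ge_1) auto
  have "summable (\<lambda>k. x ^ k / (fact k * pochhammer b k))"
  proof (rule summable_comparison_test')
    show "summable (\<lambda>k. inverse (fact k) * x ^ k)" by (rule summable_exp)
    fix k :: nat
    have "x ^ k / (fact k * pochhammer b k) \<le> x ^ k / (fact k * 1)"
      using assms *[of k] by (intro divide_left_mono mult_left_mono) auto
    then show "norm (x ^ k / (fact k * pochhammer b k)) \<le> inverse (fact k) * x ^ k"
      using assms *[of k] by (simp add: field_simps)
  qed
  then show ?thesis by (simp add: hypergeo_0F1_def summable_sums)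
qed

text \<open>The k-th term of the \<open>0F1\<close> series turns the density into a product of two
  Gamma kernels of shape \<open>k + b\<close>, tilted by the exponential to the rates
  \<open>\<beta> + u\<close> and \<open>\<beta> + v\<close>. The integrated terms form a negative
  binomial series in \<open>z / P\<close>, which sums to a multiple of
  \<open>(P - z) powr (- b)\<close>.\<close>

lemma nn_integral_bivariate_gamma_density_exp:
  fixes \<nu> r u v :: real
  assumes nu: "\<nu> \<ge> 2" and r: "\<bar>r\<bar> < 1" and u: "u \<ge> 0" and v: "v \<ge> 0"
  shows "(\<integral>\<^sup>+p. ennreal (bivariate_gamma_density \<nu> r p) * ennreal (exp (- (u * fst p + v * snd p)))
            \<partial>(lborel \<Otimes>\<^sub>M lborel))
         = ennreal (((1 + 2 / \<nu> * u) * (1 + 2 / \<nu> * v) - (2 / \<nu>)\<^sup>2 * u * v * r\<^sup>2) powr (- (\<nu> / 2)))"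
proof -
  define b where "b = \<nu> / 2"
  define s where "s = 1 - r\<^sup>2"
  \<comment> \<open>\<open>\<beta>\<close> is the rate \<open>\<nu> / (2 * (1 - r\<^sup>2))\<close>
    in the exponential of the density; with \<open>z\<close> as defined next, the argument of
    \<open>0F1\<close> is \<open>z * x * y\<close>.\<close>
  define \<beta> where "\<beta> = b / s"
  define z where "z = \<beta>\<^sup>2 * r\<^sup>2"
  define C where "C = b powr \<nu> / ((Gamma b)\<^sup>2 * s powr b)"
  define c where "c = (\<lambda>k. C * z ^ k / (fact k * pochhammer b k))"
  define h where "h = (\<lambda>k w x. indicator {0<..} x * (x powr (real k + b - 1) * exp (- ((\<beta> + w) * x))) :: real)"
  have b: "b \<ge> 1" using nu by (simp add: b_def)
  have "r\<^sup>2 < 1" using r by (simp add: abs_square_less_1)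
  then have s: "s > 0" "s \<le> 1" by (auto simp: s_def)
  have \<beta>: "\<beta> > 0" using b s by (simp add: \<beta>_def)
  have G: "Gamma b > 0" using b by simp
  then have Gne: "Gamma b \<noteq> 0" by linarith
  have C: "C > 0" unfolding C_def using b s by (intro divide_pos_pos mult_pos_pos zero_less_power G) auto
  have poch: "pochhammer b k > 0" for k using b by (intro pochhammer_pos) auto
  have z: "z \<ge> 0" by (simp add: z_def)
  have c: "c k \<ge> 0" for k using C poch[of k] z by (simp add: c_def)
  have h0: "h k w x \<ge> 0" for k w x by (simp add: h_def)
  have [measurable]: "h k w \<in> borel_measurable borel" for k w unfolding h_def by measurable
  have dens: "ennreal (bivariate_gamma_density \<nu> r p) * ennreal (exp (- (u * fst p + v * snd p)))
      = (\<Sum>k. ennreal (c k) * (ennreal (h k u (fst p)) * ennreal (h k v (snd p))))" for p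
  proof (cases "fst p > 0 \<and> snd p > 0")
    case False
    then have "fst p \<le> 0 \<or> snd p \<le> 0" by auto
    then show ?thesis by (auto simp: h_def bivariate_gamma_density_def split: prod.splits)
  next
    case True
    define x y where "x = fst p" and "y = snd p"
    have xy: "x > 0" "y > 0" using True by (auto simp: x_def y_def)
    define E where "E = x powr (b - 1) * y powr (b - 1) * exp (- ((\<beta> + u) * x)) * exp (- ((\<beta> + v) * y))"
    have E: "E \<ge> 0" by (simp add: E_def)
    have C': "2 powr (- \<nu>) * \<nu> powr \<nu> = b powr \<nu>"
      using nu by (simp add: b_def powr_divide powr_minus field_simps)
    have e1: "- (\<nu> * (x + y)) / (2 * (1 - r\<^sup>2)) = - (\<beta> * x) - \<beta> * y"
      using s by (simp add: \<beta>_def b_def s_def[symmetric] field_simps)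
    have e2: "\<nu>\<^sup>2 * r\<^sup>2 * x * y / (4 * (1 - r\<^sup>2)\<^sup>2) = z * x * y"
      unfolding z_def \<beta>_def b_def s_def[symmetric] using s by (simp add: power_divide field_simps)
    have "bivariate_gamma_density \<nu> r p * exp (- (u * fst p + v * snd p))
      = C * (x * y) powr (b - 1) * exp (- (\<beta> * x) - \<beta> * y) * hypergeo_0F1 b (z * x * y) * exp (- (u * x + v * y))"
      using xy unfolding bivariate_gamma_density_def split_beta x_def[symmetric] y_def[symmetric] e1 e2 C'
      by (simp add: C_def b_def s_def)
    also have "\<dots> = C * E * hypergeo_0F1 b (z * x * y)"
      using xy by (simp add: E_def powr_mult exp_add[symmetric] algebra_simps exp_diff exp_minus)
        (simp add: exp_add field_simps)
    finally have D: "bivariate_gamma_density \<nu> r p * exp (- (u * fst p + v * snd p)) = C * E * hypergeo_0F1 b (z * x * y)" .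
    have "(\<lambda>k. C * E * ((z * x * y) ^ k / (fact k * pochhammer b k))) sums (C * E * hypergeo_0F1 b (z * x * y))"
      using b z xy by (intro sums_mult hypergeo_0F1_sums) auto
    moreover have "C * E * ((z * x * y) ^ k / (fact k * pochhammer b k)) = c k * (h k u x * h k v y)" for k
    proof -
      have h1: "h k w t = t ^ k * (t powr (b - 1) * exp (- ((\<beta> + w) * t)))" if "t > 0" for w t
      proof -
        have "real k + b - 1 = real k + (b - 1)" by simp
        then show ?thesis using that unfolding h_def by (simp only: powr_add powr_realpow) simp
      qed
      show ?thesis using xy by (simp add: h1 c_def E_def power_mult_distrib)
    qed
    ultimately have S: "(\<lambda>k. c k * (h k u x * h k v y)) sums (C * E * hypergeo_0F1 b (z * x * y))" by simp
    have "(\<Sum>k. ennreal (c k) * (ennreal (h k u x) * ennreal (h k v y))) = (\<Sum>k. ennreal (c k * (h k u x * h k v y)))"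
      using c h0 by (simp add: ennreal_mult)
    also have "\<dots> = ennreal (C * E * hypergeo_0F1 b (z * x * y))"
      using S c h0 by (subst suminf_ennreal2) (auto simp: sums_iff)
    also have "\<dots> = ennreal (bivariate_gamma_density \<nu> r p) * ennreal (exp (- (u * fst p + v * snd p)))"
      unfolding D[symmetric] by (rule ennreal_mult'') simp
    finally show ?thesis by (simp add: x_def y_def)
  qed
  define P where "P = (\<beta> + u) * (\<beta> + v)"
  have P0: "\<beta> + u > 0" "\<beta> + v > 0" using u v \<beta> by auto
  then have P: "P > 0" by (simp add: P_def)
  define T where "T = (1 + 2 / \<nu> * u) * (1 + 2 / \<nu> * v) - (2 / \<nu>)\<^sup>2 * u * v * r\<^sup>2"
  \<comment> \<open>Expanding gives \<open>\<beta>\<^sup>2 * s + \<beta> * (u + v) + u * v\<close>;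
    as \<open>\<beta> = b / s\<close>, pulling out \<open>b\<^sup>2 / s\<close> leaves the
    determinant \<open>T\<close>.\<close>
  have PzT: "P - z = T * (b\<^sup>2 / s)"
  proof -
    have "z = \<beta>\<^sup>2 - \<beta>\<^sup>2 * s" by (simp add: z_def s_def algebra_simps)
    then have "P - z = \<beta>\<^sup>2 * s + \<beta> * (u + v) + u * v" by (simp add: P_def algebra_simps power2_eq_square)
    also have "\<dots> = (1 + (u + v) / b + s * u * v / b\<^sup>2) * (b\<^sup>2 / s)"
      using s b by (simp add: \<beta>_def field_simps power2_eq_square)
    also have "1 + (u + v) / b + s * u * v / b\<^sup>2 = T"
      using b nu by (simp add: T_def b_def s_def field_simps power2_eq_square)
    finally show ?thesis .
  qed
  \<comment> \<open>In terms of \<open>s = 1 - r\<^sup>2\<close> no negative term is left.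
    Positivity of \<open>T\<close> is what gives \<open>z / P < 1\<close>, hence convergence of the
    binomial series.\<close>
  have "T = (1 + 2 / \<nu> * u) + 2 / \<nu> * v + (2 / \<nu>)\<^sup>2 * u * v * s"
    by (simp add: T_def s_def algebra_simps power2_eq_square diff_divide_distrib)
  also have "\<dots> > 0" using u v nu s by (intro add_pos_nonneg) auto
  finally have T: "T > 0" .
  have zP: "0 \<le> z / P" "z / P < 1"
  proof -
    have "P - z > 0" unfolding PzT using T b s by simp
    then show "0 \<le> z / P" "z / P < 1" using z P by auto
  qed
  have hint: "(\<integral>\<^sup>+x. ennreal (h k w x) \<partial>lborel) = ennreal (Gamma (real k + b) * (\<beta> + w) powr (- (real k + b)))"
    if "\<beta> + w > 0" for k w
    unfolding h_def using nn_integral_Gamma_scaled[of "real k + b" "\<beta> + w"] b that by simp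
  have coeff: "ennreal (c k) * ((\<integral>\<^sup>+x. ennreal (h k u x) \<partial>lborel) * (\<integral>\<^sup>+x. ennreal (h k v x) \<partial>lborel))
      = ennreal (C * (Gamma b)\<^sup>2 * P powr (- b) * (pochhammer b k / fact k * (z / P) ^ k))" for k
  proof -
    have Gk: "Gamma (real k + b) > 0" using b by simp
    have p1: "Gamma (real k + b) = pochhammer b k * Gamma b"
      using b nonpos_Ints_nonpos[of b] Gne by (subst pochhammer_Gamma) (auto simp: add.commute)
    have pp: "w powr (- (real k + b)) = w powr (- b) / w ^ k" if "w > 0" for w
    proof -
      have "- (real k + b) = - b - real k" by simp
      then show ?thesis using that by (simp only: powr_diff powr_realpow)
    qed
    have "ennreal (c k) * ((\<integral>\<^sup>+x. ennreal (h k u x) \<partial>lborel) * (\<integral>\<^sup>+x. ennreal (h k v x) \<partial>lborel))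
      = ennreal (c k * ((Gamma (real k + b) * (\<beta> + u) powr (- (real k + b))) * (Gamma (real k + b) * (\<beta> + v) powr (- (real k + b)))))"
      unfolding hint[OF P0(1)] hint[OF P0(2)] using c[of k] Gk by (simp add: ennreal_mult)
    also have "(c k * ((Gamma (real k + b) * (\<beta> + u) powr (- (real k + b))) * (Gamma (real k + b) * (\<beta> + v) powr (- (real k + b)))))
      = C * (Gamma b)\<^sup>2 * P powr (- b) * (pochhammer b k / fact k * (z / P) ^ k)"
    proof -
      have P1: "P powr (- b) = (\<beta> + u) powr (- b) * (\<beta> + v) powr (- b)"
        using P0 by (simp add: P_def powr_mult)
      have P2: "(z / P) ^ k = z ^ k / ((\<beta> + u) ^ k * (\<beta> + v) ^ k)"
        by (simp add: P_def power_divide power_mult_distrib)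
      show ?thesis
        unfolding p1 pp[OF P0(1)] pp[OF P0(2)] c_def P1 P2 using poch[of k] by (simp add: power2_eq_square mult_ac)
    qed
    finally show ?thesis .
  qed
  have "(\<integral>\<^sup>+p. ennreal (bivariate_gamma_density \<nu> r p) * ennreal (exp (- (u * fst p + v * snd p))) \<partial>(lborel \<Otimes>\<^sub>M lborel))
     = (\<integral>\<^sup>+x. \<integral>\<^sup>+y. (\<Sum>k. ennreal (c k) * (ennreal (h k u x) * ennreal (h k v y))) \<partial>lborel \<partial>lborel)"
    unfolding dens by (subst lborel.nn_integral_fst[symmetric]) simp_all
  also have "\<dots> = (\<Sum>k. ennreal (c k) * ((\<integral>\<^sup>+x. ennreal (h k u x) \<partial>lborel) * (\<integral>\<^sup>+x. ennreal (h k v x) \<partial>lborel)))"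
    by (simp add: nn_integral_suminf nn_integral_cmult nn_integral_multc)
  also have "\<dots> = (\<Sum>k. ennreal (C * (Gamma b)\<^sup>2 * P powr (- b) * (pochhammer b k / fact k * (z / P) ^ k)))"
    unfolding coeff ..
  also have "\<dots> = ennreal (C * (Gamma b)\<^sup>2 * P powr (- b) * (1 - z / P) powr (- b))"
  proof -
    have "(\<lambda>k. C * (Gamma b)\<^sup>2 * P powr (- b) * (pochhammer b k / fact k * (z / P) ^ k)) sums
       (C * (Gamma b)\<^sup>2 * P powr (- b) * (1 - z / P) powr (- b))"
      using zP by (intro sums_mult negative_binomial_series) auto
    moreover have "C * (Gamma b)\<^sup>2 * P powr (- b) * (pochhammer b k / fact k * (z / P) ^ k) \<ge> 0" for k
      using C zP poch[of k] by (intro mult_nonneg_nonneg divide_nonneg_pos) auto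
    ultimately show ?thesis by (subst suminf_ennreal2) (auto simp: sums_iff)
  qed
  \<comment> \<open>\<open>C * (Gamma b)\<^sup>2\<close> equals
    \<open>b powr \<nu> / s powr b\<close>, the reciprocal of
    \<open>(b\<^sup>2 / s) powr (- b)\<close>, so the normalising constant disappears.\<close>
  also have "C * (Gamma b)\<^sup>2 * P powr (- b) * (1 - z / P) powr (- b) = T powr (- b)"
  proof -
    have "P powr (- b) * (1 - z / P) powr (- b) = (P - z) powr (- b)"
      using P zP by (simp add: powr_mult[symmetric] algebra_simps)
    also have "\<dots> = T powr (- b) * (s powr b / b powr \<nu>)"
    proof -
      have "(b\<^sup>2 / s) powr (- b) = s powr b / (b\<^sup>2) powr b"
        using b s by (simp add: powr_divide powr_minus)
      also have "(b\<^sup>2) powr b = b powr \<nu>"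
      proof -
        have "b\<^sup>2 = b powr 2" using b by simp
        then have "(b\<^sup>2) powr b = b powr (2 * b)" by (simp only: powr_powr)
        then show ?thesis by (simp add: b_def)
      qed
      finally have F: "(b\<^sup>2 / s) powr (- b) = s powr b / b powr \<nu>" .
      have "(T * (b\<^sup>2 / s)) powr (- b) = T powr (- b) * (b\<^sup>2 / s) powr (- b)"
        by (rule powr_mult)
      then show ?thesis unfolding PzT F .
    qed
    finally show ?thesis using Gne b s by (simp add: C_def mult.assoc)
  qed
  finally show ?thesis by (simp add: T_def b_def)
qed

subsection \<open>Gaussian variables\<close>

text \<open>Completing the square turns the integrand times the standard density into a multiple of
  the normal density with mean \<open>- B / A\<close> and variance \<open>1 / A\<close>. The
  coefficient is written \<open>A - 1\<close> because the standard density adds 1 to it.\<close>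

lemma integral_std_normal_exp_quadratic:
  fixes A B :: real
  assumes A: "A > 0"
  shows "(\<integral>m. exp (- ((A - 1) * m\<^sup>2 / 2 + B * m)) \<partial>std_normal_distribution)
           = A powr (- 1 / 2) * exp (B\<^sup>2 / (2 * A))"
proof -
  have eq: "std_normal_density m * exp (- ((A - 1) * m\<^sup>2 / 2 + B * m))
      = A powr (- 1 / 2) * exp (B\<^sup>2 / (2 * A)) * normal_density (- B / A) (1 / sqrt A) m" for m
  proof -
    have "- m\<^sup>2 / 2 + - ((A - 1) * m\<^sup>2 / 2 + B * m) = B\<^sup>2 / (2 * A) + - (m - (- B / A))\<^sup>2 / (2 * (1 / sqrt A)\<^sup>2)"
      using A by (simp add: power_divide field_simps power2_eq_square)
    then have e: "exp (- m\<^sup>2 / 2) * exp (- ((A - 1) * m\<^sup>2 / 2 + B * m))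
        = exp (B\<^sup>2 / (2 * A)) * exp (- (m - (- B / A))\<^sup>2 / (2 * (1 / sqrt A)\<^sup>2))"
      by (simp only: exp_add[symmetric])
    have f: "1 / sqrt (2 * pi) = A powr (- 1 / 2) * (1 / sqrt (2 * pi * (1 / sqrt A)\<^sup>2))"
      using A by (simp add: power_divide real_sqrt_divide powr_minus powr_half_sqrt field_simps)
    have "std_normal_density m * exp (- ((A - 1) * m\<^sup>2 / 2 + B * m))
      = 1 / sqrt (2 * pi) * (exp (- m\<^sup>2 / 2) * exp (- ((A - 1) * m\<^sup>2 / 2 + B * m)))"
      by (simp add: std_normal_density_def)
    also have "\<dots> = A powr (- 1 / 2) * exp (B\<^sup>2 / (2 * A)) * normal_density (- B / A) (1 / sqrt A) m"
      unfolding e normal_density_def by (subst f) (simp only: mult_ac)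
    finally show ?thesis .
  qed
  have "(\<integral>m. exp (- ((A - 1) * m\<^sup>2 / 2 + B * m)) \<partial>std_normal_distribution)
      = (\<integral>m. std_normal_density m * exp (- ((A - 1) * m\<^sup>2 / 2 + B * m)) \<partial>lborel)"
    by (subst integral_density) auto
  also have "\<dots> = A powr (- 1 / 2) * exp (B\<^sup>2 / (2 * A)) * (\<integral>m. normal_density (- B / A) (1 / sqrt A) m \<partial>lborel)"
    unfolding eq by simp
  also have "(\<integral>m. normal_density (- B / A) (1 / sqrt A) m \<partial>lborel) = 1"
    using A by (intro integral_normal_density) simp
  finally show ?thesis by simp
qed

text \<open>A Gaussian factor is linearised by the characteristic function of an auxiliary standard normal variable.\<close>

lemma (in prob_space) expectation_exp_square_mult:
  fixes X :: "'a \<Rightarrow> real" and g :: "'a \<Rightarrow> complex"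
  assumes [measurable]: "X \<in> borel_measurable M" "g \<in> borel_measurable M"
    and g: "\<And>\<omega>. norm (g \<omega>) \<le> 1"
  shows "(\<integral>\<omega>. of_real (exp (- (c\<^sup>2 / 2 * (X \<omega>)\<^sup>2))) * g \<omega> \<partial>M)
       = (\<integral>n. (\<integral>\<omega>. iexp (c * n * X \<omega>) * g \<omega> \<partial>M) \<partial>std_normal_distribution)"
proof -
  interpret N: prob_space std_normal_distribution
    by (rule prob_space_normal_density) simp
  interpret pair_prob_space std_normal_distribution M ..
  have lin: "of_real (exp (- (c\<^sup>2 / 2 * (X \<omega>)\<^sup>2))) * g \<omega> = (\<integral>n. iexp (c * n * X \<omega>) * g \<omega> \<partial>std_normal_distribution)" for \<omega>
  proof -
    have "of_real (exp (- (c\<^sup>2 / 2 * (X \<omega>)\<^sup>2))) = char std_normal_distribution (c * X \<omega>)"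
      unfolding char_std_normal_distribution by (simp add: power_mult_distrib)
    also have "\<dots> = (\<integral>n. iexp (c * n * X \<omega>) \<partial>std_normal_distribution)"
      unfolding char_def by (simp add: mult_ac)
    finally show ?thesis by simp
  qed
  have "(\<integral>\<omega>. of_real (exp (- (c\<^sup>2 / 2 * (X \<omega>)\<^sup>2))) * g \<omega> \<partial>M)
      = (\<integral>\<omega>. (\<integral>n. iexp (c * n * X \<omega>) * g \<omega> \<partial>std_normal_distribution) \<partial>M)"
    unfolding lin ..
  also have "\<dots> = (\<integral>n. (\<integral>\<omega>. iexp (c * n * X \<omega>) * g \<omega> \<partial>M) \<partial>std_normal_distribution)"
  proof (rule Fubini_integral)
    \<comment> \<open>The bound on \<open>g\<close> keeps the integrand in the unit disc, and a
      bounded measurable function is integrable for a product of two probability measures.\<close>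
    show "integrable (std_normal_distribution \<Otimes>\<^sub>M M) (\<lambda>(n, \<omega>). iexp (c * n * X \<omega>) * g \<omega>)"
    proof (rule P.integrable_const_bound[where B = 1])
      show "AE x in std_normal_distribution \<Otimes>\<^sub>M M. norm (case x of (n, \<omega>) \<Rightarrow> iexp (c * n * X \<omega>) * g \<omega>) \<le> 1"
        using g by (auto simp: norm_mult)
    qed simp
  qed
  finally show ?thesis .
qed

text \<open>Linearising both squares reduces the claim to the joint characteristic function at
  \<open>(p * n, q * m)\<close>, integrated against two auxiliary standard normals. No joint density
  of \<open>X\<close> and \<open>Y\<close> is used, so \<open>\<bar>r\<bar> = 1\<close> is
  included.\<close>

lemma (in prob_space) expectation_exp_squares:
  fixes X Y :: "'a \<Rightarrow> real" and r :: real
  assumes [measurable]: "X \<in> borel_measurable M" "Y \<in> borel_measurable M"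
    and char: "\<And>\<alpha> \<beta>. (\<integral>\<omega>. iexp (\<alpha> * X \<omega> + \<beta> * Y \<omega>) \<partial>M) = of_real (exp (- ((\<alpha>\<^sup>2 + \<beta>\<^sup>2 + 2 * \<alpha> * \<beta> * r) / 2)))"
    and r: "\<bar>r\<bar> \<le> 1" and a: "a \<ge> 0" and b: "b \<ge> 0"
  shows "expectation (\<lambda>\<omega>. exp (- (a * (X \<omega>)\<^sup>2 + b * (Y \<omega>)\<^sup>2)))
           = ((1 + 2 * a) * (1 + 2 * b) - 4 * a * b * r\<^sup>2) powr (- 1 / 2)"
proof -
  let ?N = std_normal_distribution
  define p q where "p = sqrt (2 * a)" and "q = sqrt (2 * b)"
  have pq: "a = p\<^sup>2 / 2" "b = q\<^sup>2 / 2" using a b by (auto simp: p_def q_def)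
  define A where "A = 1 + q\<^sup>2"
  have A: "A > 0" by (simp add: A_def add_pos_nonneg)
  \<comment> \<open>\<open>A\<close> is the coefficient of \<open>m\<^sup>2\<close> in the total
    quadratic form and \<open>D\<close> the coefficient of \<open>n\<^sup>2\<close> that remains
    once \<open>m\<close> is integrated out, a Schur complement. Hence \<open>A * D\<close> is the
    determinant in the claim.\<close>
  define D where "D = 1 + p\<^sup>2 - p\<^sup>2 * q\<^sup>2 * r\<^sup>2 / A"
  have "r\<^sup>2 \<le> 1" using r by (simp add: abs_square_le_1)
  then have "p\<^sup>2 * q\<^sup>2 * r\<^sup>2 \<le> p\<^sup>2 * q\<^sup>2 * 1" by (intro mult_left_mono) auto
  also have "\<dots> \<le> p\<^sup>2 * A" by (simp add: A_def algebra_simps)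
  finally have "p\<^sup>2 * q\<^sup>2 * r\<^sup>2 / A \<le> p\<^sup>2" using A by (simp add: pos_divide_le_eq)
  then have D: "D > 0" by (simp add: D_def)
  have inner: "(\<integral>m. exp (- (((p * n)\<^sup>2 + (q * m)\<^sup>2 + 2 * (p * n) * (q * m) * r) / 2)) \<partial>?N)
      = A powr (- 1 / 2) * exp (- ((D - 1) * n\<^sup>2 / 2 + 0 * n))" for n
  proof -
    have "(\<integral>m. exp (- (((p * n)\<^sup>2 + (q * m)\<^sup>2 + 2 * (p * n) * (q * m) * r) / 2)) \<partial>?N)
      = (\<integral>m. exp (- (p * n)\<^sup>2 / 2) * exp (- ((A - 1) * m\<^sup>2 / 2 + (p * q * n * r) * m)) \<partial>?N)"
      by (intro Bochner_Integration.integral_cong refl)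
         (simp add: A_def exp_add[symmetric] power2_eq_square field_simps)
    also have "\<dots> = exp (- (p * n)\<^sup>2 / 2) * (A powr (- 1 / 2) * exp ((p * q * n * r)\<^sup>2 / (2 * A)))"
      using integral_std_normal_exp_quadratic[OF A] by simp
    also have "\<dots> = A powr (- 1 / 2) * exp (- ((D - 1) * n\<^sup>2 / 2 + 0 * n))"
      using A by (simp add: D_def exp_add[symmetric] power2_eq_square field_simps)
    finally show ?thesis .
  qed
  have "complex_of_real (expectation (\<lambda>\<omega>. exp (- (a * (X \<omega>)\<^sup>2 + b * (Y \<omega>)\<^sup>2))))
      = (\<integral>\<omega>. of_real (exp (- (p\<^sup>2 / 2 * (X \<omega>)\<^sup>2))) * of_real (exp (- (q\<^sup>2 / 2 * (Y \<omega>)\<^sup>2))) \<partial>M)"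
    unfolding pq integral_complex_of_real[symmetric] of_real_mult[symmetric] exp_add[symmetric] by simp
  also have "\<dots> = (\<integral>n. (\<integral>\<omega>. iexp (p * n * X \<omega>) * of_real (exp (- (q\<^sup>2 / 2 * (Y \<omega>)\<^sup>2))) \<partial>M) \<partial>?N)"
    by (intro expectation_exp_square_mult) auto
  \<comment> \<open>Now \<open>iexp (p * n * X \<omega>)\<close> takes the role of the bounded
    factor \<open>g\<close> while the second square is linearised.\<close>
  also have "\<dots> = (\<integral>n. (\<integral>\<omega>. of_real (exp (- (q\<^sup>2 / 2 * (Y \<omega>)\<^sup>2))) * iexp (p * n * X \<omega>) \<partial>M) \<partial>?N)"
    by (simp add: mult.commute)
  also have "\<dots> = (\<integral>n. (\<integral>m. (\<integral>\<omega>. iexp (q * m * Y \<omega>) * iexp (p * n * X \<omega>) \<partial>M) \<partial>?N) \<partial>?N)"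
    by (subst expectation_exp_square_mult) auto
  also have "\<dots> = (\<integral>n. (\<integral>m. of_real (exp (- (((p * n)\<^sup>2 + (q * m)\<^sup>2 + 2 * (p * n) * (q * m) * r) / 2))) \<partial>?N) \<partial>?N)"
  proof -
    have "(\<integral>\<omega>. iexp (q * m * Y \<omega>) * iexp (p * n * X \<omega>) \<partial>M)
       = of_real (exp (- (((p * n)\<^sup>2 + (q * m)\<^sup>2 + 2 * (p * n) * (q * m) * r) / 2)))" for n m
      unfolding char[of "p * n" "q * m", symmetric]
      by (intro Bochner_Integration.integral_cong refl) (simp add: exp_add[symmetric] algebra_simps)
    then show ?thesis by simp
  qed
  also have "\<dots> = of_real (\<integral>n. (\<integral>m. exp (- (((p * n)\<^sup>2 + (q * m)\<^sup>2 + 2 * (p * n) * (q * m) * r) / 2)) \<partial>?N) \<partial>?N)"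
    by (simp only: integral_complex_of_real)
  also have "\<dots> = of_real (A powr (- 1 / 2) * (\<integral>n. exp (- ((D - 1) * n\<^sup>2 / 2 + 0 * n)) \<partial>?N))"
    unfolding inner by simp
  also have "\<dots> = of_real ((A * D) powr (- 1 / 2))"
    using integral_std_normal_exp_quadratic[OF D, of 0] A D by (simp add: powr_mult)
  finally have "expectation (\<lambda>\<omega>. exp (- (a * (X \<omega>)\<^sup>2 + b * (Y \<omega>)\<^sup>2))) = (A * D) powr (- 1 / 2)"
    by (rule of_real_eq_iff[THEN iffD1])
  also have "A * D = (1 + 2 * a) * (1 + 2 * b) - 4 * a * b * r\<^sup>2"
    unfolding D_def using A by (simp add: field_simps A_def pq)
  finally show ?thesis .
qed

section \<open>Gaussian variables and the standard Gaussian process\<close>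

context prob_space
begin

text \<open>The first two moments fix the parameters in both alternatives of
  \<open>gaussian_rv\<close>. The constant one does occur, with \<open>v = 0\<close>: for instance
  \<open>\<alpha> * G s + \<beta> * G t\<close> vanishes for \<open>s = t\<close> and
  \<open>\<beta> = - \<alpha>\<close>.\<close>

lemma gaussian_rv_iexp:
  assumes "gaussian_rv Z" and mean: "expectation Z = 0" and sq: "expectation (\<lambda>\<omega>. (Z \<omega>)\<^sup>2) = v"
  shows "(\<integral>\<omega>. iexp (Z \<omega>) \<partial>M) = of_real (exp (- (v / 2)))"
  using assms(1) unfolding gaussian_rv_def
proof (elim disjE exE conjE)
  fix \<mu> \<sigma> :: real
  assume \<sigma>: "\<sigma> > 0" and Z: "distributed M lborel Z (normal_density \<mu> \<sigma>)"
  have \<mu>: "\<mu> = 0" using normal_distributed_expectation[OF \<sigma> Z] mean by simp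
  have v: "v = \<sigma>\<^sup>2" using normal_distributed_variance[OF \<sigma> Z] sq mean by simp
  have std: "distributed M lborel (\<lambda>\<omega>. Z \<omega> / \<sigma>) std_normal_density"
    using Z normal_standard_normal_convert[OF \<sigma>, of Z 0] \<mu> by simp
  then have d: "distr M lborel (\<lambda>\<omega>. Z \<omega> / \<sigma>) = std_normal_distribution"
    by (simp add: distributed_def)
  have [measurable]: "(\<lambda>\<omega>. Z \<omega> / \<sigma>) \<in> borel_measurable M"
    using distributed_measurable[OF std] by simp
  have "(\<integral>\<omega>. iexp (Z \<omega>) \<partial>M) = (\<integral>\<omega>. iexp (\<sigma> * (Z \<omega> / \<sigma>)) \<partial>M)"
    using \<sigma> by simp
  also have "\<dots> = (\<integral>x. iexp (\<sigma> * x) \<partial>distr M lborel (\<lambda>\<omega>. Z \<omega> / \<sigma>))"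
    by (subst integral_distr) auto
  also have "\<dots> = char std_normal_distribution \<sigma>"
    unfolding d char_def ..
  finally show ?thesis by (simp add: char_std_normal_distribution v)
next
  fix \<mu> :: real
  assume [measurable]: "random_variable borel Z" and ae: "AE \<omega> in M. Z \<omega> = \<mu>"
  have "expectation Z = expectation (\<lambda>_. \<mu>)" using ae by (intro integral_cong_AE) auto
  then have \<mu>: "\<mu> = 0" using mean by (simp add: prob_space)
  have "expectation (\<lambda>\<omega>. (Z \<omega>)\<^sup>2) = expectation (\<lambda>_. 0)" using ae \<mu> by (intro integral_cong_AE) auto
  then have v: "v = 0" using sq by simp
  have "(\<integral>\<omega>. iexp (Z \<omega>) \<partial>M) = (\<integral>\<omega>. 1 \<partial>M)" using ae \<mu> by (intro integral_cong_AE) auto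
  then show ?thesis by (simp add: v prob_space)
qed

text \<open>Positivity of the sums of squares rests on this. The positive second moment rules out
  the constant alternative, and a law with a density gives no mass to a point.\<close>

lemma gaussian_rv_AE_nonzero:
  assumes "gaussian_rv Z" and mean: "expectation Z = 0" and sq: "expectation (\<lambda>\<omega>. (Z \<omega>)\<^sup>2) > 0"
  shows "AE \<omega> in M. Z \<omega> \<noteq> 0"
  using assms(1) unfolding gaussian_rv_def
proof (elim disjE exE conjE)
  fix \<mu> \<sigma> :: real
  assume \<sigma>: "\<sigma> > 0" and Z: "distributed M lborel Z (normal_density \<mu> \<sigma>)"
  have "AE x in lborel. x \<noteq> (0 :: real)" by (rule AE_lborel_singleton)
  then have "AE x in lborel. 0 < ennreal (normal_density \<mu> \<sigma> x) \<longrightarrow> x \<noteq> 0" by eventually_elim simp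
  then have "AE x in distr M lborel Z. x \<noteq> 0"
    by (subst distributed_distr_eq_density[OF Z], subst AE_density) auto
  then show ?thesis
    by (subst (asm) AE_distr_iff) (use distributed_measurable[OF Z] in auto)
next
  fix \<mu> :: real
  assume [measurable]: "random_variable borel Z" and ae: "AE \<omega> in M. Z \<omega> = \<mu>"
  have "expectation Z = expectation (\<lambda>_. \<mu>)" using ae by (intro integral_cong_AE) auto
  then have \<mu>: "\<mu> = 0" using mean by (simp add: prob_space)
  have "expectation (\<lambda>\<omega>. (Z \<omega>)\<^sup>2) = expectation (\<lambda>_. 0)" using ae \<mu> by (intro integral_cong_AE) auto
  then show ?thesis using sq by simp
qed

lemma standard_gaussian_processD:
  assumes "standard_gaussian_process A \<rho> G" and s: "s \<in> A" and t: "t \<in> A"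
  shows "random_variable borel (G s)" "integrable M (\<lambda>\<omega>. (G s \<omega>)\<^sup>2)" "expectation (\<lambda>\<omega>. (G s \<omega>)\<^sup>2) = 1"
    "integrable M (G s)" "expectation (G s) = 0" "AE \<omega> in M. G s \<omega> \<noteq> 0"
    "integrable M (\<lambda>\<omega>. G s \<omega> * G t \<omega>)" "expectation (\<lambda>\<omega>. G s \<omega> * G t \<omega>) = \<rho> (s - t)"
    "\<bar>\<rho> (s - t)\<bar> \<le> 1"
    "a \<ge> 0 \<Longrightarrow> b \<ge> 0 \<Longrightarrow> expectation (\<lambda>\<omega>. exp (- (a * (G s \<omega>)\<^sup>2 + b * (G t \<omega>)\<^sup>2)))
           = ((1 + 2 * a) * (1 + 2 * b) - 4 * a * b * (\<rho> (s - t))\<^sup>2) powr (- 1 / 2)"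
proof -
  note std = assms(1)[unfolded standard_gaussian_process_def has_correlation_function_def]
  have gauss: "gaussian_process A G" using std by blast
  have rv [measurable]: "random_variable borel (G s)" "random_variable borel (G t)" using std s t by auto
  have m: "expectation (G s) = 0" "expectation (G t) = 0" using std s t by auto
  have sqi: "integrable M (\<lambda>\<omega>. (G s \<omega>)\<^sup>2)" "integrable M (\<lambda>\<omega>. (G t \<omega>)\<^sup>2)" using std s t by auto
  have V: "variance (G s) = 1" "variance (G t) = 1" using std s t by auto
  then have sq: "expectation (\<lambda>\<omega>. (G s \<omega>)\<^sup>2) = 1" "expectation (\<lambda>\<omega>. (G t \<omega>)\<^sup>2) = 1" using m by auto
  have i: "integrable M (G s)" "integrable M (G t)"
    using sqi by (auto intro: square_integrable_imp_integrable)
  have prodi: "integrable M (\<lambda>\<omega>. G s \<omega> * G t \<omega>)"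
  proof (rule Bochner_Integration.integrable_bound)
    show "integrable M (\<lambda>\<omega>. (G s \<omega>)\<^sup>2 + (G t \<omega>)\<^sup>2)" using sqi by simp
    have "\<bar>x * y\<bar> \<le> \<bar>x\<^sup>2 + y\<^sup>2\<bar>" for x y :: real
    proof -
      have "2 * (\<bar>x\<bar> * \<bar>y\<bar>) \<le> x\<^sup>2 + y\<^sup>2"
        using sum_squares_bound[of "\<bar>x\<bar>" "\<bar>y\<bar>"] by simp
      moreover have "0 \<le> \<bar>x\<bar> * \<bar>y\<bar>" by simp
      ultimately show ?thesis unfolding abs_mult by linarith
    qed
    then show "AE \<omega> in M. norm (G s \<omega> * G t \<omega>) \<le> norm ((G s \<omega>)\<^sup>2 + (G t \<omega>)\<^sup>2)" by simp
  qed simp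
  have "correlation (G s) (G t) = \<rho> (s - t)" using std s t by auto
  then have corr: "expectation (\<lambda>\<omega>. G s \<omega> * G t \<omega>) = \<rho> (s - t)"
    by (simp add: correlation_def covariance_def m V sq)
  have lin: "expectation (\<lambda>\<omega>. (\<alpha> * G s \<omega> + \<beta> * G t \<omega>)\<^sup>2) = \<alpha>\<^sup>2 + \<beta>\<^sup>2 + 2 * \<alpha> * \<beta> * \<rho> (s - t)" for \<alpha> \<beta>
  proof -
    have "expectation (\<lambda>\<omega>. (\<alpha> * G s \<omega> + \<beta> * G t \<omega>)\<^sup>2)
      = expectation (\<lambda>\<omega>. \<alpha>\<^sup>2 * (G s \<omega>)\<^sup>2 + \<beta>\<^sup>2 * (G t \<omega>)\<^sup>2 + 2 * \<alpha> * \<beta> * (G s \<omega> * G t \<omega>))"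
      by (intro Bochner_Integration.integral_cong refl) (simp add: power2_eq_square algebra_simps)
    also have "\<dots> = \<alpha>\<^sup>2 + \<beta>\<^sup>2 + 2 * \<alpha> * \<beta> * \<rho> (s - t)"
      using sqi prodi sq corr by simp
    finally show ?thesis .
  qed
  \<comment> \<open>These second moments are \<open>2 + 2 * \<rho> (s - t)\<close> and
    \<open>2 - 2 * \<rho> (s - t)\<close>.\<close>
  have "0 \<le> expectation (\<lambda>\<omega>. (1 * G s \<omega> + 1 * G t \<omega>)\<^sup>2)" "0 \<le> expectation (\<lambda>\<omega>. (1 * G s \<omega> + (-1) * G t \<omega>)\<^sup>2)"
    by (intro Bochner_Integration.integral_nonneg zero_le_power2)+
  then have bound: "\<bar>\<rho> (s - t)\<bar> \<le> 1" unfolding lin by simp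
  \<comment> \<open>For \<open>s = t\<close> the set \<open>{s, t}\<close> is a singleton and a
    weight function on it would lose \<open>\<beta>\<close>, so the coefficients are added
    instead.\<close>
  have gl: "gaussian_rv (\<lambda>\<omega>. \<alpha> * G s \<omega> + \<beta> * G t \<omega>)" for \<alpha> \<beta>
  proof (cases "s = t")
    case True
    have "gaussian_rv (\<lambda>\<omega>. \<Sum>x\<in>{s}. (\<alpha> + \<beta>) * G x \<omega>)"
      using gauss s unfolding gaussian_process_def by (elim allE[of _ "{s}"] allE[of _ "\<lambda>_. \<alpha> + \<beta>"]) simp
    then show ?thesis using True by (simp add: algebra_simps)
  next
    case False
    have "gaussian_rv (\<lambda>\<omega>. \<Sum>x\<in>{s, t}. (if x = s then \<alpha> else \<beta>) * G x \<omega>)"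
      using gauss s t unfolding gaussian_process_def
      by (elim allE[of _ "{s, t}"] allE[of _ "\<lambda>x. if x = s then \<alpha> else \<beta>"]) simp
    then show ?thesis using False by simp
  qed
  have char: "(\<integral>\<omega>. iexp (\<alpha> * G s \<omega> + \<beta> * G t \<omega>) \<partial>M)
      = of_real (exp (- ((\<alpha>\<^sup>2 + \<beta>\<^sup>2 + 2 * \<alpha> * \<beta> * \<rho> (s - t)) / 2)))" for \<alpha> \<beta>
    using i m by (intro gaussian_rv_iexp gl lin) simp
  show "random_variable borel (G s)" "integrable M (\<lambda>\<omega>. (G s \<omega>)\<^sup>2)" "expectation (\<lambda>\<omega>. (G s \<omega>)\<^sup>2) = 1"
    "integrable M (G s)" "expectation (G s) = 0"
    "integrable M (\<lambda>\<omega>. G s \<omega> * G t \<omega>)" "expectation (\<lambda>\<omega>. G s \<omega> * G t \<omega>) = \<rho> (s - t)"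
    "\<bar>\<rho> (s - t)\<bar> \<le> 1"
    by fact+
  show "AE \<omega> in M. G s \<omega> \<noteq> 0"
    using gl[of 1 0] m sq by (intro gaussian_rv_AE_nonzero) auto
  show "expectation (\<lambda>\<omega>. exp (- (a * (G s \<omega>)\<^sup>2 + b * (G t \<omega>)\<^sup>2)))
           = ((1 + 2 * a) * (1 + 2 * b) - 4 * a * b * (\<rho> (s - t))\<^sup>2) powr (- 1 / 2)" if "a \<ge> 0" "b \<ge> 0"
    by (rule expectation_exp_squares[OF rv char bound that])
qed

end

subsection \<open>Mixing processes\<close>

context prob_space
begin

text \<open>The mixing process is prescribed on \<open>space M\<close> only, so it need not equal
  the composed map as a function on the whole type.\<close>

lemma indep_var_cong_space:
  assumes "\<And>\<omega>. \<omega> \<in> space M \<Longrightarrow> X \<omega> = X' \<omega>" "\<And>\<omega>. \<omega> \<in> space M \<Longrightarrow> Y \<omega> = Y' \<omega>"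
  shows "indep_var S X T Y \<longleftrightarrow> indep_var S X' T Y'"
proof -
  have "X -` B \<inter> space M = X' -` B \<inter> space M" "Y -` C \<inter> space M = Y' -` C \<inter> space M" for B C
    using assms by auto
  moreover have "X \<in> M \<rightarrow>\<^sub>M S \<longleftrightarrow> X' \<in> M \<rightarrow>\<^sub>M S" "Y \<in> M \<rightarrow>\<^sub>M T \<longleftrightarrow> Y' \<in> M \<rightarrow>\<^sub>M T"
    using assms by (auto intro!: measurable_cong)
  ultimately show ?thesis unfolding indep_var_eq by simp
qed

section \<open>Integer degrees of freedom: sums of squares\<close>

lemma path_on_component:
  "s \<in> A \<Longrightarrow> path_on A Q \<omega> s = Q s \<omega>"
  by (simp add: path_on_def)

text \<open>Mutual independence over \<open>{0..n}\<close> is grouped into the blocks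
  \<open>{1..n}\<close> and \<open>{0}\<close>: the pair from \<open>W\<close> is a measurable
  function of the first block, the pair from \<open>G\<close> of the second.\<close>

lemma chi_square_mixing_indep:
  assumes chi: "chi_square_mixing A n G W" and s: "s \<in> A" and t: "t \<in> A"
  shows "indep_var (borel \<Otimes>\<^sub>M borel) (\<lambda>\<omega>. (W s \<omega>, W t \<omega>)) (borel \<Otimes>\<^sub>M borel) (\<lambda>\<omega>. (G s \<omega>, G t \<omega>))"
proof -
  obtain H where ind: "indep_vars (\<lambda>_. Pi\<^sub>M A (\<lambda>_. borel)) (\<lambda>i. path_on A (if i = 0 then G else H i)) {0..n}"
    and W: "\<And>s \<omega>. s \<in> A \<Longrightarrow> \<omega> \<in> space M \<Longrightarrow> W s \<omega> = 1 / real n * (\<Sum>i=1..n. (H i s \<omega>)\<^sup>2)"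
    using chi unfolding chi_square_mixing_def by blast
  let ?P = "\<lambda>_::nat. Pi\<^sub>M A (\<lambda>_. borel :: real measure)"
  let ?X = "\<lambda>i. path_on A (if i = 0 then G else H i)"
  let ?w = "\<lambda>p s. 1 / real n * (\<Sum>i=1..n. (p i s)\<^sup>2) :: real"
  have "indep_var (PiM {1..n} ?P) (\<lambda>\<omega>. restrict (\<lambda>i. ?X i \<omega>) {1..n}) (PiM {0} ?P) (\<lambda>\<omega>. restrict (\<lambda>i. ?X i \<omega>) {0})"
    by (rule indep_var_restrict[OF ind]) auto
  moreover have "(\<lambda>p. p i x) \<in> PiM I ?P \<rightarrow>\<^sub>M borel" if "i \<in> I" "x \<in> A" for i I x
    using that measurable_compose[OF measurable_component_singleton[of i I ?P] measurable_component_singleton[of x A "\<lambda>_. borel :: real measure"]]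
    by simp
  then have "(\<lambda>p. (?w p s, ?w p t)) \<in> PiM {1..n} ?P \<rightarrow>\<^sub>M borel \<Otimes>\<^sub>M borel"
      "(\<lambda>p. (p 0 s, p 0 t)) \<in> PiM {0} ?P \<rightarrow>\<^sub>M borel \<Otimes>\<^sub>M borel"
    using s t by (auto intro!: measurable_Pair borel_measurable_times borel_measurable_sum borel_measurable_power)
  ultimately have "indep_var (borel \<Otimes>\<^sub>M borel) ((\<lambda>p. (?w p s, ?w p t)) \<circ> (\<lambda>\<omega>. restrict (\<lambda>i. ?X i \<omega>) {1..n}))
      (borel \<Otimes>\<^sub>M borel) ((\<lambda>p. (p 0 s, p 0 t)) \<circ> (\<lambda>\<omega>. restrict (\<lambda>i. ?X i \<omega>) {0}))"
    by (rule indep_var_compose)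
  then show ?thesis
    by (rule indep_var_cong_space[THEN iffD1, rotated -1]) (use s t in \<open>auto simp: W path_on_component\<close>)
qed

text \<open>Independence makes the transform a product over the copies, and equality of the path
  laws replaces each factor by the one for \<open>G\<close>. The n factors with exponent
  \<open>-1/2\<close> give \<open>- n / 2\<close>.\<close>

lemma chi_square_mixing_Laplace:
  assumes G: "standard_gaussian_process A \<rho> G" and chi: "chi_square_mixing A n G W" and n: "n > 0"
    and s: "s \<in> A" and t: "t \<in> A"
  shows "random_variable borel (W s)" "AE \<omega> in M. W s \<omega> > 0"
    "u \<ge> 0 \<Longrightarrow> v \<ge> 0 \<Longrightarrow> (\<integral>\<^sup>+\<omega>. ennreal (exp (- (u * W s \<omega> + v * W t \<omega>))) \<partial>M)
       = ennreal (((1 + 2 / real n * u) * (1 + 2 / real n * v) - (2 / real n)\<^sup>2 * u * v * (\<rho> (s - t))\<^sup>2) powr (- (real n / 2)))"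
proof -
  obtain H where ind: "indep_vars (\<lambda>_. Pi\<^sub>M A (\<lambda>_. borel)) (\<lambda>i. path_on A (if i = 0 then G else H i)) {0..n}"
    and H: "\<And>i. i \<in> {1..n} \<Longrightarrow> distr M (Pi\<^sub>M A (\<lambda>_. borel)) (path_on A (H i)) = distr M (Pi\<^sub>M A (\<lambda>_. borel)) (path_on A G)"
    and W: "\<And>s \<omega>. s \<in> A \<Longrightarrow> \<omega> \<in> space M \<Longrightarrow> W s \<omega> = 1 / real n * (\<Sum>i=1..n. (H i s \<omega>)\<^sup>2)"
    using chi unfolding chi_square_mixing_def by blast
  let ?P = "Pi\<^sub>M A (\<lambda>_. borel :: real measure)"
  have Gm: "path_on A G \<in> M \<rightarrow>\<^sub>M ?P"
    using ind by (auto simp: indep_vars_def dest: bspec[of _ _ 0])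
  have Hm: "path_on A (H i) \<in> M \<rightarrow>\<^sub>M ?P" if "i \<in> {1..n}" for i
    using ind that by (auto simp: indep_vars_def dest: bspec[of _ _ i])
  have comp [measurable]: "(\<lambda>p. p s) \<in> ?P \<rightarrow>\<^sub>M borel" "(\<lambda>p. p t) \<in> ?P \<rightarrow>\<^sub>M borel"
    using s t by auto
  have Hs [measurable]: "H i s \<in> borel_measurable M" "H i t \<in> borel_measurable M" if "i \<in> {1..n}" for i
    using measurable_compose[OF Hm[OF that] comp(1)] measurable_compose[OF Hm[OF that] comp(2)] s t
    by (simp_all add: path_on_component)
  have "(\<lambda>\<omega>. 1 / real n * (\<Sum>i=1..n. (H i s \<omega>)\<^sup>2)) \<in> borel_measurable M" by measurable
  then show "random_variable borel (W s)"
    by (rule measurable_cong[THEN iffD1, rotated]) (simp add: W s)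
  \<comment> \<open>One nonvanishing square is enough for \<open>W s > 0\<close>, so only
    \<open>H 1\<close> is examined; its nonvanishing is carried over from \<open>G\<close> through
    the common law.\<close>
  have one: "1 \<in> {1..n}" using n by simp
  have "AE \<omega> in M. path_on A G \<omega> s \<noteq> 0"
    using standard_gaussian_processD(6)[OF G s t] s by (simp add: path_on_component)
  then have "AE p in distr M ?P (path_on A G). p s \<noteq> 0"
    by (subst AE_distr_iff) (use Gm in auto)
  then have "AE p in distr M ?P (path_on A (H 1)). p s \<noteq> 0"
    by (simp only: H[OF one])
  then have "AE \<omega> in M. H 1 s \<omega> \<noteq> 0"
    by (subst (asm) AE_distr_iff) (use Hm[OF one] s in \<open>auto simp: path_on_component\<close>)
  with AE_space show "AE \<omega> in M. W s \<omega> > 0"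
  proof eventually_elim
    case (elim \<omega>)
    have "(\<Sum>i=1..n. (H i s \<omega>)\<^sup>2) > 0"
      using elim one by (intro sum_pos2[where i = 1]) auto
    then show ?case using elim n by (simp add: W s)
  qed
  assume uv: "u \<ge> 0" "v \<ge> 0"
  \<comment> \<open>The factor \<open>1 / n\<close> in the definition of \<open>W\<close> is
    absorbed here, so that \<open>2 * a = 2 / n * u\<close>.\<close>
  define a b where "a = u / real n" and "b = v / real n"
  have ab: "a \<ge> 0" "b \<ge> 0" using uv by (auto simp: a_def b_def)
  define T where "T = (1 + 2 * a) * (1 + 2 * b) - 4 * a * b * (\<rho> (s - t))\<^sup>2"
  define \<phi> where "\<phi> = (\<lambda>p. exp (- (a * (p s)\<^sup>2 + b * (p t)\<^sup>2)) :: real)"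
  have \<phi> [measurable]: "\<phi> \<in> borel_measurable ?P" unfolding \<phi>_def by measurable
  have EG: "(\<integral>\<^sup>+\<omega>. ennreal (\<phi> (path_on A G \<omega>)) \<partial>M) = ennreal (T powr (- 1 / 2))"
  proof -
    have "expectation (\<lambda>\<omega>. \<phi> (path_on A G \<omega>)) = T powr (- 1 / 2)"
      using standard_gaussian_processD(10)[OF G s t ab] s t by (simp add: \<phi>_def path_on_component T_def)
    moreover have "integrable M (\<lambda>\<omega>. \<phi> (path_on A G \<omega>))"
    proof (rule integrable_const_bound[where B = 1])
      show "(\<lambda>\<omega>. \<phi> (path_on A G \<omega>)) \<in> borel_measurable M" by (rule measurable_compose[OF Gm \<phi>])
      have "0 \<le> a * (p s)\<^sup>2 + b * (p t)\<^sup>2" for p :: "_ \<Rightarrow> real" using ab by simp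
      then show "AE \<omega> in M. norm (\<phi> (path_on A G \<omega>)) \<le> 1"
        unfolding \<phi>_def norm_exp real_norm_def abs_exp_cancel exp_le_one_iff neg_le_0_iff_le by simp
    qed
    ultimately show ?thesis by (subst nn_integral_eq_integral) (auto simp: \<phi>_def)
  qed
  have EH: "(\<integral>\<^sup>+\<omega>. ennreal (\<phi> (path_on A (H i) \<omega>)) \<partial>M) = ennreal (T powr (- 1 / 2))" if "i \<in> {1..n}" for i
  proof -
    have "(\<integral>\<^sup>+\<omega>. ennreal (\<phi> (path_on A (H i) \<omega>)) \<partial>M) = (\<integral>\<^sup>+p. ennreal (\<phi> p) \<partial>distr M ?P (path_on A (H i)))"
      using Hm[OF that] by (subst nn_integral_distr) auto
    also have "\<dots> = (\<integral>\<^sup>+\<omega>. ennreal (\<phi> (path_on A G \<omega>)) \<partial>M)"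
      unfolding H[OF that] using Gm by (subst nn_integral_distr) auto
    finally show ?thesis unfolding EG .
  qed
  have indH: "indep_vars (\<lambda>_. borel) (\<lambda>i \<omega>. ennreal (\<phi> (path_on A (if i = 0 then G else H i) \<omega>))) {1..n}"
    by (rule indep_vars_compose2[OF indep_vars_subset[OF ind]]) auto
  have "(\<integral>\<^sup>+\<omega>. ennreal (exp (- (u * W s \<omega> + v * W t \<omega>))) \<partial>M)
     = (\<integral>\<^sup>+\<omega>. (\<Prod>i\<in>{1..n}. ennreal (\<phi> (path_on A (if i = 0 then G else H i) \<omega>))) \<partial>M)"
  proof (intro nn_integral_cong)
    fix \<omega> assume \<omega>: "\<omega> \<in> space M"
    have "- (u * W s \<omega> + v * W t \<omega>) = (\<Sum>i=1..n. - (a * (H i s \<omega>)\<^sup>2 + b * (H i t \<omega>)\<^sup>2))"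
      using n by (simp add: W[OF s \<omega>] W[OF t \<omega>] a_def b_def sum_negf sum_subtractf sum_distrib_left)
    then have "exp (- (u * W s \<omega> + v * W t \<omega>)) = (\<Prod>i\<in>{1..n}. exp (- (a * (H i s \<omega>)\<^sup>2 + b * (H i t \<omega>)\<^sup>2)))"
      by (simp only: exp_sum finite_atLeastAtMost)
    also have "\<dots> = (\<Prod>i\<in>{1..n}. \<phi> (path_on A (if i = 0 then G else H i) \<omega>))"
      using s t by (intro prod.cong refl) (simp add: \<phi>_def path_on_component)
    finally show "ennreal (exp (- (u * W s \<omega> + v * W t \<omega>))) = (\<Prod>i\<in>{1..n}. ennreal (\<phi> (path_on A (if i = 0 then G else H i) \<omega>)))"
      by (simp only: prod_ennreal \<phi>_def exp_ge_zero)
  qed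
  also have "\<dots> = (\<Prod>i\<in>{1..n}. (\<integral>\<^sup>+\<omega>. ennreal (\<phi> (path_on A (if i = 0 then G else H i) \<omega>)) \<partial>M))"
    by (rule indep_vars_nn_integral[OF _ indH]) auto
  also have "\<dots> = (\<Prod>i\<in>{1..n}. ennreal (T powr (- 1 / 2)))"
    using EH by (intro prod.cong refl) simp
  also have "\<dots> = ennreal ((T powr (- 1 / 2)) ^ n)"
    by (simp add: ennreal_power)
  \<comment> \<open>Turning the power into \<open>powr\<close> asks for a positive base, which
    \<open>T \<noteq> 0\<close> provides; at \<open>T = 0\<close> both sides are 0 because
    \<open>n > 0\<close>.\<close>
  also have "(T powr (- 1 / 2)) ^ n = T powr (- (real n / 2))"
    by (cases "T = 0") (use n in \<open>simp_all add: powr_realpow[symmetric] powr_powr\<close>)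
  also have "T = (1 + 2 / real n * u) * (1 + 2 / real n * v) - (2 / real n)\<^sup>2 * u * v * (\<rho> (s - t))\<^sup>2"
    by (simp add: T_def a_def b_def power_divide power2_eq_square)
  finally show "(\<integral>\<^sup>+\<omega>. ennreal (exp (- (u * W s \<omega> + v * W t \<omega>))) \<partial>M)
     = ennreal (((1 + 2 / real n * u) * (1 + 2 / real n * v) - (2 / real n)\<^sup>2 * u * v * (\<rho> (s - t))\<^sup>2) powr (- (real n / 2)))" .
qed

section \<open>Non-integer degrees of freedom: Gamma mixing\<close>

lemma gamma_mixing_indep:
  assumes W: "gamma_mixing A \<nu> \<rho> G W" and s: "s \<in> A" and t: "t \<in> A"
  shows "indep_var (borel \<Otimes>\<^sub>M borel) (\<lambda>\<omega>. (W s \<omega>, W t \<omega>)) (borel \<Otimes>\<^sub>M borel) (\<lambda>\<omega>. (G s \<omega>, G t \<omega>))"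
proof -
  have "indep_var (Pi\<^sub>M A (\<lambda>_. borel)) (path_on A W) (Pi\<^sub>M A (\<lambda>_. borel)) (path_on A G)"
    using W unfolding gamma_mixing_def by blast
  moreover have "(\<lambda>p. (p s, p t)) \<in> Pi\<^sub>M A (\<lambda>_. borel :: real measure) \<rightarrow>\<^sub>M borel \<Otimes>\<^sub>M borel"
    using s t by (intro measurable_Pair) auto
  ultimately have "indep_var (borel \<Otimes>\<^sub>M borel) ((\<lambda>p. (p s, p t)) \<circ> path_on A W)
      (borel \<Otimes>\<^sub>M borel) ((\<lambda>p. (p s, p t)) \<circ> path_on A G)"
    by (intro indep_var_compose)
  then show ?thesis using s t by (simp add: comp_def path_on_component)
qed

lemma gamma_mixing_Laplace:
  assumes W: "gamma_mixing A \<nu> \<rho> G W" and nu: "\<nu> \<ge> 2"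
    and s: "s \<in> A" and t: "t \<in> A" and r: "\<bar>\<rho> (s - t)\<bar> \<le> 1" and u: "u \<ge> 0" and v: "v \<ge> 0"
  shows "(\<integral>\<^sup>+\<omega>. ennreal (exp (- (u * W s \<omega> + v * W t \<omega>))) \<partial>M)
       = ennreal (((1 + 2 / \<nu> * u) * (1 + 2 / \<nu> * v) - (2 / \<nu>)\<^sup>2 * u * v * (\<rho> (s - t))\<^sup>2) powr (- (\<nu> / 2)))"
proof (cases "\<bar>\<rho> (s - t)\<bar> < 1")
  case True
  then have "distributed M (lborel \<Otimes>\<^sub>M lborel) (\<lambda>\<omega>. (W s \<omega>, W t \<omega>)) (bivariate_gamma_density \<nu> (\<rho> (s - t)))"
    using W s t unfolding gamma_mixing_def by blast
  from distributed_nn_integral[OF this, of "\<lambda>p. ennreal (exp (- (u * fst p + v * snd p)))"]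
  show ?thesis
    using nn_integral_bivariate_gamma_density_exp[OF nu True u v] by simp
next
  case False
  with r have r1: "\<bar>\<rho> (s - t)\<bar> = 1" by simp
  then have ae: "AE \<omega> in M. W s \<omega> = W t \<omega>" and
    d: "distributed M lborel (W t) (gamma_density (\<nu> / 2) (\<nu> / 2))"
    using W s t unfolding gamma_mixing_def by blast+
  have "(\<integral>\<^sup>+\<omega>. ennreal (exp (- (u * W s \<omega> + v * W t \<omega>))) \<partial>M) = (\<integral>\<^sup>+\<omega>. ennreal (exp (- ((u + v) * W t \<omega>))) \<partial>M)"
    using ae by (intro nn_integral_cong_AE, eventually_elim) (simp add: algebra_simps)
  also have "\<dots> = ennreal ((1 + 2 / \<nu> * (u + v)) powr (- (\<nu> / 2)))"
    using distributed_nn_integral[OF d, of "\<lambda>x. ennreal (exp (- ((u + v) * x)))"]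
      nn_integral_gamma_density_exp[of \<nu> "u + v"] nu u v by simp
  \<comment> \<open>At \<open>(\<rho> (s - t))\<^sup>2 = 1\<close> the mixed terms in
    \<open>u * v\<close> cancel, so the degenerate pair obeys the same formula as the pairs with a
    density.\<close>
  also have "1 + 2 / \<nu> * (u + v) = (1 + 2 / \<nu> * u) * (1 + 2 / \<nu> * v) - (2 / \<nu>)\<^sup>2 * u * v * (\<rho> (s - t))\<^sup>2"
  proof -
    have "(\<rho> (s - t))\<^sup>2 = 1" using r1 by (metis power2_abs one_power2)
    then show ?thesis by (simp add: algebra_simps add_divide_distrib power2_eq_square)
  qed
  finally show ?thesis .
qed

text \<open>The integer and the non-integer case merge here; the moments and the correlation are
  computed from these four facts alone.\<close>

lemma mixing_processD:
  assumes G: "standard_gaussian_process A \<rho> G" and W: "mixing_process A \<nu> \<rho> G W" and nu: "\<nu> > 2"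
    and s: "s \<in> A" and t: "t \<in> A"
  shows "random_variable borel (W s)" "AE \<omega> in M. W s \<omega> > 0"
    "indep_var (borel \<Otimes>\<^sub>M borel) (\<lambda>\<omega>. (W s \<omega>, W t \<omega>)) (borel \<Otimes>\<^sub>M borel) (\<lambda>\<omega>. (G s \<omega>, G t \<omega>))"
    "u \<ge> 0 \<Longrightarrow> v \<ge> 0 \<Longrightarrow> (\<integral>\<^sup>+\<omega>. ennreal (exp (- (u * W s \<omega> + v * W t \<omega>))) \<partial>M)
       = ennreal (((1 + 2 / \<nu> * u) * (1 + 2 / \<nu> * v) - (2 / \<nu>)\<^sup>2 * u * v * (\<rho> (s - t))\<^sup>2) powr (- (\<nu> / 2)))"
proof -
  note r = standard_gaussian_processD(9)[OF G s t]
  consider n where "\<nu> = real n" "chi_square_mixing A n G W" | "gamma_mixing A \<nu> \<rho> G W"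
    using W unfolding mixing_process_def by blast
  then have "random_variable borel (W s) \<and> (AE \<omega> in M. W s \<omega> > 0) \<and>
    indep_var (borel \<Otimes>\<^sub>M borel) (\<lambda>\<omega>. (W s \<omega>, W t \<omega>)) (borel \<Otimes>\<^sub>M borel) (\<lambda>\<omega>. (G s \<omega>, G t \<omega>)) \<and>
    (u \<ge> 0 \<longrightarrow> v \<ge> 0 \<longrightarrow> (\<integral>\<^sup>+\<omega>. ennreal (exp (- (u * W s \<omega> + v * W t \<omega>))) \<partial>M)
       = ennreal (((1 + 2 / \<nu> * u) * (1 + 2 / \<nu> * v) - (2 / \<nu>)\<^sup>2 * u * v * (\<rho> (s - t))\<^sup>2) powr (- (\<nu> / 2))))"
  proof cases
    case (1 n)
    then have "n > 0" using nu by simp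
    then show ?thesis
      using chi_square_mixing_indep[OF 1(2) s t] chi_square_mixing_Laplace[OF G 1(2) _ s t] 1(1) by blast
  next
    case 2
    then have "distributed M lborel (W s) (gamma_density (\<nu> / 2) (\<nu> / 2))" "AE \<omega> in M. W s \<omega> > 0"
      using s unfolding gamma_mixing_def by blast+
    then show ?thesis
      using gamma_mixing_indep[OF 2 s t] gamma_mixing_Laplace[OF 2 _ s t r] nu distributed_measurable by fastforce
  qed
  then show "random_variable borel (W s)" "AE \<omega> in M. W s \<omega> > 0"
    "indep_var (borel \<Otimes>\<^sub>M borel) (\<lambda>\<omega>. (W s \<omega>, W t \<omega>)) (borel \<Otimes>\<^sub>M borel) (\<lambda>\<omega>. (G s \<omega>, G t \<omega>))"
    "u \<ge> 0 \<Longrightarrow> v \<ge> 0 \<Longrightarrow> (\<integral>\<^sup>+\<omega>. ennreal (exp (- (u * W s \<omega> + v * W t \<omega>))) \<partial>M)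
       = ennreal (((1 + 2 / \<nu> * u) * (1 + 2 / \<nu> * v) - (2 / \<nu>)\<^sup>2 * u * v * (\<rho> (s - t))\<^sup>2) powr (- (\<nu> / 2)))"
    by blast+
qed

text \<open>Order matters: the inverse moment is finite first, it then dominates the mixed product,
  and only the resulting finite expectation turns the \<open>ennreal\<close> series into a real
  one.\<close>

lemma mixing_process_moments:
  assumes G: "standard_gaussian_process A \<rho> G" and W: "mixing_process A \<nu> \<rho> G W" and nu: "\<nu> > 2"
    and s: "s \<in> A" and t: "t \<in> A"
  shows "integrable M (\<lambda>\<omega>. W s \<omega> powr (- 1 / 2))"
    "integrable M (\<lambda>\<omega>. W s \<omega> powr (- 1 / 2) * W t \<omega> powr (- 1 / 2))"
    "expectation (\<lambda>\<omega>. W s \<omega> powr (- 1 / 2) * W s \<omega> powr (- 1 / 2)) = \<nu> / (\<nu> - 2)"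
    "expectation (\<lambda>\<omega>. W s \<omega> powr (- 1 / 2) * W t \<omega> powr (- 1 / 2))
       = \<nu> / 2 * (Gamma ((\<nu> - 1) / 2))\<^sup>2 / (Gamma (\<nu> / 2))\<^sup>2 * hypergeo_2F1 (1 / 2) (1 / 2) (\<nu> / 2) ((\<rho> (s - t))\<^sup>2)"
proof -
  let ?K = "\<lambda>s \<omega>. W s \<omega> powr (- 1 / 2)"
  have Wm [measurable]: "random_variable borel (W x)" and pos: "AE \<omega> in M. W x \<omega> > 0" if "x \<in> A" for x
    using mixing_processD(1,2)[OF G W nu that that] by auto
  have inv: "(\<integral>\<^sup>+\<omega>. ennreal (?K x \<omega> * ?K x \<omega>) \<partial>M) = ennreal (\<nu> / (\<nu> - 2))" if x: "x \<in> A" for x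
  proof -
    have half: "w powr (- 1 / 2) * w powr (- 1 / 2) = 1 / w" if "w > 0" for w :: real
    proof -
      have "w powr (- 1 / 2) * w powr (- 1 / 2) = w powr (- 1)"
        unfolding powr_add[symmetric] by simp
      then show ?thesis using that by (simp add: powr_minus_divide)
    qed
    have "(\<integral>\<^sup>+\<omega>. ennreal (?K x \<omega> * ?K x \<omega>) \<partial>M) = (\<integral>\<^sup>+\<omega>. ennreal (1 / W x \<omega>) \<partial>M)"
      using pos[OF x] by (intro nn_integral_cong_AE, eventually_elim) (simp only: half)
    also have "\<dots> = ennreal (\<nu> / (\<nu> - 2))"
      \<comment> \<open>Setting the second argument to 0 in the joint transform leaves that of a
        single variable.\<close>
      using mixing_processD(4)[OF G W nu x x, of _ 0] Wm[OF x] pos[OF x] nu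
      by (intro nn_integral_inverse_Laplace) auto
    finally show ?thesis .
  qed
  have sqi: "integrable M (\<lambda>\<omega>. ?K x \<omega> * ?K x \<omega>)" if x: "x \<in> A" for x
  proof (rule integrableI_nonneg)
    show "(\<lambda>\<omega>. ?K x \<omega> * ?K x \<omega>) \<in> borel_measurable M" using Wm[OF x] by measurable
    show "(\<integral>\<^sup>+\<omega>. ennreal (?K x \<omega> * ?K x \<omega>) \<partial>M) < \<infinity>" unfolding inv[OF x] by simp
  qed simp
  show "integrable M (?K s)"
  proof (rule square_integrable_imp_integrable)
    show "?K s \<in> borel_measurable M" using Wm[OF s] by measurable
    show "integrable M (\<lambda>\<omega>. (?K s \<omega>)\<^sup>2)" unfolding power2_eq_square by (rule sqi[OF s])
  qed
  show i: "integrable M (\<lambda>\<omega>. ?K s \<omega> * ?K t \<omega>)"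
  proof (rule Bochner_Integration.integrable_bound)
    show "integrable M (\<lambda>\<omega>. ?K s \<omega> * ?K s \<omega> + ?K t \<omega> * ?K t \<omega>)" using sqi s t by simp
    show "(\<lambda>\<omega>. ?K s \<omega> * ?K t \<omega>) \<in> borel_measurable M" using Wm[OF s] Wm[OF t] by measurable
    have "x * y \<le> x * x + y * y" if "x \<ge> 0" "y \<ge> 0" for x y :: real
      using sum_squares_bound[of x y] mult_nonneg_nonneg[OF that] unfolding power2_eq_square by linarith
    then show "AE \<omega> in M. norm (?K s \<omega> * ?K t \<omega>) \<le> norm (?K s \<omega> * ?K s \<omega> + ?K t \<omega> * ?K t \<omega>)"
      by simp
  qed
  show "expectation (\<lambda>\<omega>. ?K s \<omega> * ?K s \<omega>) = \<nu> / (\<nu> - 2)"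
  proof -
    have "ennreal (expectation (\<lambda>\<omega>. ?K s \<omega> * ?K s \<omega>)) = ennreal (\<nu> / (\<nu> - 2))"
      unfolding inv[OF s, symmetric] by (rule nn_integral_eq_integral[symmetric, OF sqi[OF s]]) simp
    then show ?thesis
      using nu by (subst (asm) ennreal_inj) (simp_all add: Bochner_Integration.integral_nonneg)
  qed
  define C where "C = \<nu> / 2 * (Gamma ((\<nu> - 1) / 2))\<^sup>2 / (Gamma (\<nu> / 2))\<^sup>2"
  define f where "f = (\<lambda>k. pochhammer (1 / 2) k * pochhammer (1 / 2) k / pochhammer (\<nu> / 2) k * (((\<rho> (s - t))\<^sup>2) ^ k / fact k))"
  have "Gamma ((\<nu> - 1) / 2) > 0" "Gamma (\<nu> / 2) > 0" using nu by auto
  then have C: "C > 0" unfolding C_def using nu by (intro divide_pos_pos mult_pos_pos zero_less_power) auto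
  have f: "f k \<ge> 0" for k
    unfolding f_def using nu by (intro mult_nonneg_nonneg divide_nonneg_nonneg pochhammer_nonneg) auto
  have "ennreal (expectation (\<lambda>\<omega>. ?K s \<omega> * ?K t \<omega>)) = (\<integral>\<^sup>+\<omega>. ennreal (?K s \<omega> * ?K t \<omega>) \<partial>M)"
    using i by (intro nn_integral_eq_integral[symmetric]) auto
  also have "\<dots> = (\<Sum>k. ennreal (C * f k))"
    unfolding C_def f_def
    using mixing_processD(4)[OF G W nu s t] standard_gaussian_processD(9)[OF G s t] Wm pos s t nu
    by (intro nn_integral_inverse_sqrt_prod_Laplace) auto
  finally have *: "(\<Sum>k. ennreal (C * f k)) = ennreal (expectation (\<lambda>\<omega>. ?K s \<omega> * ?K t \<omega>))" by simp
  \<comment> \<open>Convergence of the hypergeometric series is read off from the finite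
    expectation, uniformly for all admissible \<open>\<rho> (s - t)\<close>.\<close>
  then have sm: "summable (\<lambda>k. C * f k)"
    using C f by (intro summable_suminf_not_top) auto
  then have "ennreal (\<Sum>k. C * f k) = ennreal (expectation (\<lambda>\<omega>. ?K s \<omega> * ?K t \<omega>))"
    using * C f by (subst (asm) suminf_ennreal2) auto
  then have "expectation (\<lambda>\<omega>. ?K s \<omega> * ?K t \<omega>) = (\<Sum>k. C * f k)"
    using C f sm by (subst (asm) ennreal_inj) (auto intro!: suminf_nonneg Bochner_Integration.integral_nonneg)
  also have "\<dots> = C * suminf f"
    using sm C by (intro suminf_mult) (simp add: summable_cmult_iff)
  finally show "expectation (\<lambda>\<omega>. ?K s \<omega> * ?K t \<omega>)
       = \<nu> / 2 * (Gamma ((\<nu> - 1) / 2))\<^sup>2 / (Gamma (\<nu> / 2))\<^sup>2 * hypergeo_2F1 (1 / 2) (1 / 2) (\<nu> / 2) ((\<rho> (s - t))\<^sup>2)"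
    by (simp add: C_def f_def hypergeo_2F1_def)
qed

text \<open>Independence of the pairs \<open>(W s, W t)\<close> and \<open>(G s, G t)\<close> splits
  the mixed moment of \<open>Y\<close> into an inverse moment of \<open>W\<close> times
  \<open>\<rho> (s - t)\<close>. Means vanish with those of \<open>G\<close>, so covariances are
  plain mixed moments.\<close>

lemma standard_t_process_correlation:
  assumes nu: "\<nu> > 2" and Y: "standard_t_process A \<nu> \<rho> Y"
  shows "has_correlation_function A Y
     (\<lambda>h. (\<nu> - 2) * (Gamma ((\<nu> - 1) / 2))\<^sup>2 / (2 * (Gamma (\<nu> / 2))\<^sup>2)
                  * (hypergeo_2F1 (1 / 2) (1 / 2) (\<nu> / 2) ((\<rho> h)\<^sup>2) * \<rho> h))"
proof -
  obtain G W where G: "standard_gaussian_process A \<rho> G" and W: "mixing_process A \<nu> \<rho> G W"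
    and Yeq: "\<And>s \<omega>. s \<in> A \<Longrightarrow> \<omega> \<in> space M \<Longrightarrow> Y s \<omega> = W s \<omega> powr (- 1 / 2) * G s \<omega>"
    using Y unfolding standard_t_process_def by blast
  let ?K = "\<lambda>s \<omega>. W s \<omega> powr (- 1 / 2)"
  have rv: "random_variable borel (Y s)" if s: "s \<in> A" for s
  proof -
    have [measurable]: "random_variable borel (W s)" "random_variable borel (G s)"
      using mixing_processD(1)[OF G W nu s s] standard_gaussian_processD(1)[OF G s s] by auto
    have "(\<lambda>\<omega>. ?K s \<omega> * G s \<omega>) \<in> borel_measurable M" by measurable
    then show ?thesis by (rule measurable_cong[THEN iffD1, rotated]) (simp add: Yeq s)
  qed
  have ind: "indep_var borel (f \<circ> (\<lambda>\<omega>. (W s \<omega>, W t \<omega>))) borel (g \<circ> (\<lambda>\<omega>. (G s \<omega>, G t \<omega>)))"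
    if "s \<in> A" "t \<in> A" "f \<in> borel_measurable (borel \<Otimes>\<^sub>M borel)" "g \<in> borel_measurable (borel \<Otimes>\<^sub>M borel)"
    for s t and f g :: "real \<times> real \<Rightarrow> real"
    using mixing_processD(3)[OF G W nu that(1,2)] that(3,4) by (rule indep_var_compose)
  have mean: "expectation (Y s) = 0" if s: "s \<in> A" for s
  proof -
    have iv: "indep_var borel (?K s) borel (G s)"
      using ind[OF s s, of "\<lambda>p. fst p powr (- 1 / 2)" fst] by (simp add: comp_def)
    have "expectation (Y s) = expectation (\<lambda>\<omega>. ?K s \<omega> * G s \<omega>)"
      by (intro Bochner_Integration.integral_cong refl) (simp add: Yeq s)
    also have "\<dots> = expectation (?K s) * expectation (G s)"
      by (intro indep_var_lebesgue_integral iv mixing_process_moments(1)[OF G W nu s s] standard_gaussian_processD(4)[OF G s s])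
    finally show ?thesis using standard_gaussian_processD(5)[OF G s s] by simp
  qed
  have prod: "integrable M (\<lambda>\<omega>. Y s \<omega> * Y t \<omega>)"
    "expectation (\<lambda>\<omega>. Y s \<omega> * Y t \<omega>) = expectation (\<lambda>\<omega>. ?K s \<omega> * ?K t \<omega>) * \<rho> (s - t)"
    if s: "s \<in> A" and t: "t \<in> A" for s t
  proof -
    have iv: "indep_var borel (\<lambda>\<omega>. ?K s \<omega> * ?K t \<omega>) borel (\<lambda>\<omega>. G s \<omega> * G t \<omega>)"
      using ind[OF s t, of "\<lambda>p. fst p powr (- 1 / 2) * snd p powr (- 1 / 2)" "\<lambda>p. fst p * snd p"]
      by (simp add: comp_def)
    note int = iv mixing_process_moments(2)[OF G W nu s t] standard_gaussian_processD(7)[OF G s t]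
    have eq: "Y s \<omega> * Y t \<omega> = (?K s \<omega> * ?K t \<omega>) * (G s \<omega> * G t \<omega>)" if "\<omega> \<in> space M" for \<omega>
      using that by (simp add: Yeq s t)
    show "integrable M (\<lambda>\<omega>. Y s \<omega> * Y t \<omega>)"
      using indep_var_integrable[OF int] by (rule Bochner_Integration.integrable_cong[THEN iffD2, rotated -1]) (simp_all add: eq)
    have "expectation (\<lambda>\<omega>. Y s \<omega> * Y t \<omega>) = expectation (\<lambda>\<omega>. (?K s \<omega> * ?K t \<omega>) * (G s \<omega> * G t \<omega>))"
      by (intro Bochner_Integration.integral_cong refl eq)
    then show "expectation (\<lambda>\<omega>. Y s \<omega> * Y t \<omega>) = expectation (\<lambda>\<omega>. ?K s \<omega> * ?K t \<omega>) * \<rho> (s - t)"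
      using indep_var_lebesgue_integral[OF int] standard_gaussian_processD(8)[OF G s t] by simp
  qed
  have var: "variance (Y s) = \<nu> / (\<nu> - 2)" if s: "s \<in> A" for s
  proof -
    \<comment> \<open>The value at lag 0 follows from the unit second moment of \<open>G s\<close>;
      the variance then comes from the inverse moment of \<open>W s\<close> instead of the series at
      argument 1.\<close>
    have "\<rho> (s - s) = 1"
      using standard_gaussian_processD(3,8)[OF G s s] by (simp add: power2_eq_square)
    then show ?thesis
      using prod(2)[OF s s] mixing_process_moments(3)[OF G W nu s s] mean[OF s] by (simp add: power2_eq_square)
  qed
  show ?thesis
    unfolding has_correlation_function_def
  proof (intro conjI ballI)
    fix s assume s: "s \<in> A"
    show "random_variable borel (Y s)" by (rule rv[OF s])
    show "integrable M (\<lambda>\<omega>. (Y s \<omega>)\<^sup>2)" using prod(1)[OF s s] by (simp add: power2_eq_square)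
    show "variance (Y s) > 0" unfolding var[OF s] using nu by simp
  next
    fix s t assume s: "s \<in> A" and t: "t \<in> A"
    have "correlation (Y s) (Y t) = expectation (\<lambda>\<omega>. ?K s \<omega> * ?K t \<omega>) * \<rho> (s - t) / (\<nu> / (\<nu> - 2))"
    proof -
      have "sqrt (\<nu> / (\<nu> - 2) * (\<nu> / (\<nu> - 2))) = \<nu> / (\<nu> - 2)"
        using nu unfolding real_sqrt_abs2 by simp
      then show ?thesis
        unfolding correlation_def covariance_def var[OF s] var[OF t] using prod(2)[OF s t]
        by (simp only: mean[OF s] mean[OF t] diff_0_right)
    qed
    \<comment> \<open>The factor \<open>\<nu> / 2\<close> of the mixed moment divided by the
      variance \<open>\<nu> / (\<nu> - 2)\<close> yields \<open>(\<nu> - 2) / 2\<close>.\<close>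
    also have "\<dots> = (\<nu> - 2) * (Gamma ((\<nu> - 1) / 2))\<^sup>2 / (2 * (Gamma (\<nu> / 2))\<^sup>2)
                  * (hypergeo_2F1 (1 / 2) (1 / 2) (\<nu> / 2) ((\<rho> (s - t))\<^sup>2) * \<rho> (s - t))"
      unfolding mixing_process_moments(4)[OF G W nu s t] using nu by simp
    finally show "correlation (Y s) (Y t) = (\<nu> - 2) * (Gamma ((\<nu> - 1) / 2))\<^sup>2 / (2 * (Gamma (\<nu> / 2))\<^sup>2)
                  * (hypergeo_2F1 (1 / 2) (1 / 2) (\<nu> / 2) ((\<rho> (s - t))\<^sup>2) * \<rho> (s - t))" .
  qed
qed

end

theorem theorem2p1:
  fixes M :: "'w measure"
    and A :: "(real ^ 'd) set"
    and \<nu> :: real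
    and \<rho> :: "real ^ 'd \<Rightarrow> real"
    and Y :: "real ^ 'd \<Rightarrow> 'w \<Rightarrow> real"
  assumes "prob_space M"
    and "\<nu> > 2"
    and "prob_space.standard_t_process M A \<nu> \<rho> Y"
  shows "prob_space.has_correlation_function M A Y
           (\<lambda>h. (\<nu> - 2) * (Gamma ((\<nu> - 1) / 2))\<^sup>2 / (2 * (Gamma (\<nu> / 2))\<^sup>2)
                  * (hypergeo_2F1 (1 / 2) (1 / 2) (\<nu> / 2) ((\<rho> h)\<^sup>2) * \<rho> h))"
  using assms by (intro prob_space.standard_t_process_correlation)

end
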